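(* Let $\{g_d(n)\}_{d,n\ge1}$ be a double sequence in $\mathbb{D}$ (defined in the context). Let $n\ge 3$ be an integer with $n\ne 5$. Let $R$ be the radius of convergence of $\sum_{n\ge1} g_1(n)\frac{q^n}{n}$. For each $x>0$ let $r(x)$ be a real number with $0<r(x)<R$ and $P_m^{g_1}(x)\le r(x)^{-m}$ for all $m\ge 0$. Let $\Delta_n^{g_d}(x)=\left(P_n^{g_d}(x)\right)^2-P_{n-1}^{g_d}(x)P_{n+1}^{g_d}(x)$. Then: \begin{itemize} \item[(i)] If $n\equiv 0\pmod 3$ and $x>0$, then $\Delta_n^{g_d}(x)\ge 0$ for all $d\ge d_0(n,x)$, where $$d_0(n,x)=1+\frac{2n}{3\ln(9/8)}\left(\ln(n/3)-\ln(x)-3\ln(r(x))\right).$$ \item[(ii)] If $n\equiv 1\pmod 3$ and $x>0$, then $\Delta_n^{g_d}(x)<0$ for all $d\ge d_0(n,x)$, where $$d_0(n,x)=1+\frac{2n}{3\ln(9/8)}\left(\ln\!\left(\frac{n-1}{3}\right)-\ln(x)-3\ln(r(x))\right).$$ \item[(iii)] If $n\equiv 2\pmod 3$ and $0<x<2-\frac{12}{n+4}$, then $\Delta_n^{g_d}(x)<0$ for all $d\ge d_0(n,x)$, where $$d_0(n,x)=1+\frac{1}{\ln(9/8)}\left(-\ln\!\left(\frac{n-2}{3n+3}\left(\frac1x+\frac12\right)-\frac13\right)+\frac{n-2}{3}\ln\!\left(\frac{n-2}{3}\right)-\frac{n+1}{3}\ln(x)-n\ln(r(x))\right).$$ \e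nd{itemize}
   Context: $\mathbb{D}$ denotes the set of all double sequences $\{g_d(n)\}_{d,n\ge1}$ of real numbers with $g_d(1)=1$ for all $d$, such that (for each $d$) the power series $\sum_{n\ge1} g_d(n)q^{n-1}$ is regular at $q=0$ (has positive radius of convergence), and such that for all $d,n\ge 1$ $$0\le g_d(n)-n^d\le g_1(n)\,(n-1)^{d-1}.$$ For each $d$, the polynomials $P_n^{g_d}(x)$ are defined by $P_0^{g_d}(x)=1$ and, for $n\ge1$, $$P_n^{g_d}(x)=\frac{x}{n}\sum_{k=1}^n g_d(k)\,P_{n-k}^{g_d}(x);$$ equivalently $\sum_{n\ge0}P_n^{g_d}(x)q^n=\exp\!\left(x\sum_{n\ge1}g_d(n)\frac{q^n}{n}\right)$. *)

theory Defs
  imports "HOL-Analysis.Analysis"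
begin

text \<open>A double sequence is a function \<open>g\<close> with \<open>g d n\<close> standing for \<open>g\<^sub>d(n)\<close>; only its values at
  \<open>d, n \<ge> 1\<close> matter, the values at index \<open>0\<close> are junk and never constrained.\<close>

definition double_seqs :: "(nat \<Rightarrow> nat \<Rightarrow> real) set" where
  "double_seqs = {g.
     (\<forall>d\<ge>1. g d 1 = 1) \<and>
     (\<forall>d\<ge>1. conv_radius (\<lambda>m. g d (m + 1)) > 0) \<and>
     (\<forall>d\<ge>1. \<forall>n\<ge>1. 0 \<le> g d n - real n ^ d \<and>
                   g d n - real n ^ d \<le> g 1 n * (real n - 1) ^ (d - 1))}"

fun rec_poly :: "(nat \<Rightarrow> real) \<Rightarrow> nat \<Rightarrow> real \<Rightarrow> real" where
  "rec_poly h 0 x = 1"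
| "rec_poly h (Suc n) x = x / real (Suc n) * (\<Sum>k=1..Suc n. h k * rec_poly h (Suc n - k) x)"

text \<open>Meaningful for \<open>n \<ge> 1\<close> only.\<close>

definition Delta :: "(nat \<Rightarrow> real) \<Rightarrow> nat \<Rightarrow> real \<Rightarrow> real" where
  "Delta h n x = (rec_poly h n x)\<^sup>2 - rec_poly h (n - 1) x * rec_poly h (n + 1) x"

end

theory Submission
  imports Defs
begin

text \<open>
  Put \<open>D = d - 1\<close>. Expanding the exponential generating function, \<open>P\<^sub>n(x)\<close> is a sum over the compositions
  of \<open>n\<close> in which a composition with parts \<open>m\<^sub>1, \<dots>, m\<^sub>k\<close> is weighted by roughly \<open>(m\<^sub>1 \<cdots> m\<^sub>k)\<^sup>D x\<^sup>k / k!\<close>, so for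
  large \<open>d\<close> the compositions with maximal product dominate. The maximal product is \<open>3\<^sup>k\<close>, \<open>4 \<cdot> 3\<^sup>k\<^sup>-\<^sup>1\<close>,
  \<open>2 \<cdot> 3\<^sup>k\<close> for \<open>n = 3k, 3k + 1, 3k + 2\<close>, and every other composition loses a factor of at least
  \<open>(9/8)\<^sup>D\<close>. Comparing maximal products, \<open>P\<^sub>n\<^sup>2\<close> beats \<open>P\<^sub>n\<^sub>-\<^sub>1 P\<^sub>n\<^sub>+\<^sub>1\<close> by \<open>(9/8)\<^sup>D\<close> if \<open>3\<close> divides \<open>n\<close> and
  loses by the same factor if \<open>n \<equiv> 1\<close>; if \<open>n \<equiv> 2\<close> the products agree and the leading coefficients
  decide. The hypothesis \<open>P\<^sub>m(x) \<le> r\<^sup>-\<^sup>m\<close> for \<open>d = 1\<close> controls the remaining terms; together with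
  \<open>g\<^sub>1(m) \<ge> m\<close> it also forces \<open>k / (x r\<^sup>3)\<close> to be at least \<open>1.86 k\<close>, so that \<open>D\<close> is never small.
\<close>

section \<open>Maximal products of compositions\<close>

text \<open>The largest product of the parts of a composition of \<open>n\<close>, encoded by its
  values: from 5 on a part 3 is split off. The value 4 at 4 is a base case because 2 * 2 beats 3 *
  1.\<close>

fun max_prod :: "nat \<Rightarrow> nat" where
  "max_prod 0 = 1"
| "max_prod (Suc 0) = 1"
| "max_prod (Suc (Suc 0)) = 2"
| "max_prod (Suc (Suc (Suc 0))) = 3"
| "max_prod (Suc (Suc (Suc (Suc 0)))) = 4"
| "max_prod (Suc (Suc (Suc (Suc (Suc n))))) = 3 * max_prod (Suc (Suc n))"

lemma max_prod_add_3: "n \<noteq> 1 \<Longrightarrow> max_prod (n + 3) = 3 * max_prod n"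
  by (cases n rule: max_prod.cases) (auto simp: numeral_eq_Suc)

lemma max_prod_closed:
  "max_prod (3 * k) = 3 ^ k" "max_prod (3 * k + 2) = 2 * 3 ^ k" "max_prod (3 * k + 4) = 4 * 3 ^ k"
proof (induction k)
  case 0
  {
    case 1 show ?case by simp
  next
    case 2 show ?case by (simp add: numeral_2_eq_2)
  next
    case 3 show ?case by (simp add: eval_nat_numeral)
  }
next
  case (Suc k)
  have *: "3 * Suc k = 3 * k + 3" "3 * Suc k + 2 = (3 * k + 2) + 3" "3 * Suc k + 4 = (3 * k + 4) + 3"
    by auto
  have "3 * k \<noteq> 1" by presburger
  {
    case 1 show ?case unfolding *(1) using Suc \<open>3 * k \<noteq> 1\<close> by (subst max_prod_add_3) auto
  next
    case 2 show ?case unfolding *(2) using Suc by (subst max_prod_add_3) auto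
  next
    case 3 show ?case unfolding *(3) using Suc by (subst max_prod_add_3) auto
  }
qed

lemma max_prod_shifted:
  "max_prod (3 * k + 3) = 3 * 3 ^ k" "max_prod (3 * k + 5) = 6 * 3 ^ k" "max_prod (3 * k + 6) = 9 * 3 ^ k"
  "max_prod (3 * k + 7) = 12 * 3 ^ k" "max_prod (3 * k + 8) = 18 * 3 ^ k" "max_prod (3 * k + 9) = 27 * 3 ^ k"
  "max_prod (3 * k + 10) = 36 * 3 ^ k" "max_prod (3 * k + 11) = 54 * 3 ^ k"
  using max_prod_closed[of "k + 1"] max_prod_closed[of "k + 2"] max_prod_closed[of "k + 3"]
  by (simp_all add: algebra_simps power_add)

lemma max_prod_2: "max_prod 2 = 2"
  by (simp add: numeral_2_eq_2)

text \<open>The class of 1 modulo 3 starts at 4, and 1 stands alone, because the closed form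
  \<open>4 * 3 ^ k\<close> for \<open>3 * k + 4\<close> does not extend to 1.\<close>

lemma residue_cases:
  obtains "n = 1" | k where "n = 3 * k" | k where "n = 3 * k + 2" | k where "n = 3 * k + (4::nat)"
proof -
  have "n = 1 \<or> n = 3 * (n div 3) \<or> n = 3 * (n div 3) + 2 \<or> n = 3 * (n div 3 - 1) + 4"
    by presburger
  then show ?thesis using that by metis
qed

text \<open>\<open>optimal j m\<close> characterises \<open>j * max_prod m = max_prod (m + j)\<close>; in all other cases the
  product is at most \<open>8 / 9\<close> of the maximum, which is where \<open>ln (9 / 8)\<close> comes from.\<close>

definition optimal :: "nat \<Rightarrow> nat \<Rightarrow> bool" where
  "optimal j m \<longleftrightarrow> j = 1 \<and> m = 0 \<or> j = 2 \<and> m mod 3 \<noteq> 1 \<or> j = 3 \<and> m \<noteq> 1 \<or> j = 4 \<and> m mod 3 = 0"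

lemma max_prod_add_small:
  assumes "j \<in> {1,2,3,4,5,6,7}"
  shows "if optimal j m then j * max_prod m = max_prod (m + j) else 9 * (j * max_prod m) \<le> 8 * max_prod (m + j)"
proof (cases m rule: residue_cases)
  case 1
  have "max_prod 1 = 1" "max_prod 2 = 2" "max_prod 3 = 3" "max_prod 4 = 4"
    "max_prod 5 = 6" "max_prod 6 = 9" "max_prod 7 = 12" "max_prod 8 = 18"
    using max_prod_2 max_prod_closed(3)[of 0] max_prod_shifted[of 0] by simp_all
  then show ?thesis using assms 1 by (auto simp: optimal_def)
next
  case (2 k)
  have k: "3 * k \<noteq> 1" "3 * k mod 3 = 0" by presburger+
  \<comment> \<open>For \<open>j = 1\<close> the sum \<open>3 * k + 1\<close> is covered by a closed
    form only with index \<open>k - 1\<close>, so this case is settled separately.\<close>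
  have 1: "if k = 0 then max_prod (3 * k + 1) = 3 ^ k else 9 * 3 ^ k \<le> 8 * max_prod (3 * k + 1)"
    using max_prod_closed[of "k - 1"] by (cases k) (auto simp: algebra_simps)
  show ?thesis
    using assms 2 1 k max_prod_closed[of k] max_prod_shifted[of k]
    by (elim insertE emptyE) (simp_all add: optimal_def split: if_splits)
next
  case (3 k)
  then have e: "m + 1 = 3 * k + 3" "m + 2 = 3 * k + 4" "m + 3 = 3 * k + 5" "m + 4 = 3 * k + 6"
      "m + 5 = 3 * k + 7" "m + 6 = 3 * k + 8" "m + 7 = 3 * k + 9"
    and m: "m mod 3 = 2" "m \<noteq> 0" "m \<noteq> 1" "max_prod m = 2 * 3 ^ k"
    using max_prod_closed[of k] by (simp_all, presburger?)
  have "max_prod (m + 1) = 3 * 3 ^ k" "max_prod (m + 2) = 4 * 3 ^ k" "max_prod (m + 3) = 6 * 3 ^ k"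
    "max_prod (m + 4) = 9 * 3 ^ k" "max_prod (m + 5) = 12 * 3 ^ k"
    "max_prod (m + 6) = 18 * 3 ^ k" "max_prod (m + 7) = 27 * 3 ^ k"
    unfolding e max_prod_closed max_prod_shifted by simp_all
  then show ?thesis
    using assms m by (elim insertE emptyE) (simp_all add: optimal_def)
next
  case (4 k)
  then have e: "m + 1 = 3 * k + 5" "m + 2 = 3 * k + 6" "m + 3 = 3 * k + 7" "m + 4 = 3 * k + 8"
      "m + 5 = 3 * k + 9" "m + 6 = 3 * k + 10" "m + 7 = 3 * k + 11"
    and m: "m mod 3 = 1" "m \<noteq> 0" "m \<noteq> 1" "max_prod m = 4 * 3 ^ k"
    using max_prod_closed[of k] by (simp_all, presburger?)
  have "max_prod (m + 1) = 6 * 3 ^ k" "max_prod (m + 2) = 9 * 3 ^ k" "max_prod (m + 3) = 12 * 3 ^ k"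
    "max_prod (m + 4) = 18 * 3 ^ k" "max_prod (m + 5) = 27 * 3 ^ k"
    "max_prod (m + 6) = 36 * 3 ^ k" "max_prod (m + 7) = 54 * 3 ^ k"
    unfolding e max_prod_closed max_prod_shifted by simp_all
  then show ?thesis
    using assms m by (elim insertE emptyE) (simp_all add: optimal_def)
qed

lemma max_prod_add:
  assumes "j \<ge> 1"
  shows "if optimal j m then j * max_prod m = max_prod (m + j) else 9 * (j * max_prod m) \<le> 8 * max_prod (m + j)"
  using assms
proof (induction j rule: less_induct)
  case (less j)
  show ?case
  proof (cases "j \<le> 7")
    case True
    then have "j \<in> {1,2,3,4,5,6,7}" using less.prems by auto
    then show ?thesis by (rule max_prod_add_small)
  next
    case False
    \<comment> \<open>Since \<open>j - 3 \<ge> 5\<close> exceeds every optimal part, the induction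
      hypothesis supplies the factor 8/9; this is why the direct check runs up to 7.\<close>
    have "\<not> optimal (j - 3) m"
      using False by (auto simp: optimal_def)
    then have "9 * ((j - 3) * max_prod m) \<le> 8 * max_prod (m + (j - 3))"
      using less.IH[of "j - 3"] False by simp
    moreover have "max_prod (m + j) = 3 * max_prod (m + (j - 3))"
      using max_prod_add_3[of "m + (j - 3)"] False by simp
    moreover have "j * max_prod m \<le> (3 * (j - 3)) * max_prod m"
      using False by (intro mult_right_mono) auto
    ultimately have "9 * (j * max_prod m) \<le> 8 * max_prod (m + j)"
      by (simp only: mult.assoc)
    with False show ?thesis by (auto simp: optimal_def)
  qed
qed

text \<open>The successive ratios are 4/3 from a positive multiple of 3, 2 from 1, and 3/2
  otherwise. The smallest of them is the source of \<open>\<eta> = (3 / 4) ^ D\<close>.\<close>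

lemma max_prod_Suc: "n \<ge> 1 \<Longrightarrow> 4 * max_prod n \<le> 3 * max_prod (n + 1)"
proof (cases n rule: residue_cases)
  case 1 then show ?thesis by (simp add: max_prod_2)
next
  case (2 k)
  then show "n \<ge> 1 \<Longrightarrow> ?thesis"
    using max_prod_closed(3)[of "k - 1"] max_prod_shifted(1)[of "k - 1"] by (cases k) (auto simp: algebra_simps)
next
  case (3 k)
  then have e: "n + 1 = 3 * k + 3" by simp
  show ?thesis unfolding e max_prod_shifted unfolding 3 max_prod_closed by simp
next
  case (4 k)
  then have e: "n + 1 = 3 * k + 5" by simp
  show ?thesis unfolding e max_prod_shifted unfolding 4 max_prod_closed by simp
qed

text \<open>The parts \<open>j - 1\<close> and those of \<open>m\<close> form a composition of
  \<open>m + j - 1\<close>, and the missing unit costs 3/4 by \<open>max_prod_Suc\<close>.\<close>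

lemma max_prod_pred_part:
  assumes "j \<ge> 2"
  shows "4 * ((j - 1) * max_prod m) \<le> 3 * max_prod (m + j)"
proof -
  have "(j - 1) * max_prod m \<le> max_prod (m + (j - 1))"
    using max_prod_add[of "j - 1" m] assms by (cases "optimal (j - 1) m") (simp_all, linarith)
  also have "4 * \<dots> \<le> 3 * max_prod (m + j)"
    using max_prod_Suc[of "m + (j - 1)"] assms by simp
  finally show ?thesis by simp
qed

text \<open>\<open>lead x n\<close> is the coefficient of \<open>max_prod n ^ D\<close> in the polynomial \<open>P\<^sub>n(x)\<close> for the sequence
  \<open>j\<^sup>D\<^sup>+\<^sup>1\<close>: it collects the compositions of \<open>n\<close> whose parts have maximal product.\<close>

fun lead :: "real \<Rightarrow> nat \<Rightarrow> real" where
  "lead x 0 = 1"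
| "lead x (Suc n) = x / real (Suc n) *
     (\<Sum>j=1..Suc n. if optimal j (Suc n - j) then real j * lead x (Suc n - j) else 0)"

declare lead.simps(2) [simp del] rec_poly.simps(2) [simp del]

lemma lead_eq:
  assumes "n \<ge> 1"
  shows "lead x n = x / real n * (\<Sum>j=1..n. if optimal j (n - j) then real j * lead x (n - j) else 0)"
proof -
  obtain m where "n = Suc m" using assms by (cases n) auto
  then show ?thesis by (simp only: lead.simps(2))
qed

lemma lead_rec:
  assumes "n \<ge> 1"
  shows "real n * lead x n = x * (\<Sum>j=1..n. if optimal j (n - j) then real j * lead x (n - j) else 0)"
  using lead_eq[OF assms, of x] assms by simp

lemma rec_poly_eq:
  assumes "n \<ge> 1"
  shows "rec_poly h n x = x / real n * (\<Sum>j=1..n. h j * rec_poly h (n - j) x)"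
proof -
  obtain m where "n = Suc m" using assms by (cases n) auto
  then show ?thesis by (simp only: rec_poly.simps(2))
qed

lemma rec_poly_rec:
  assumes "n \<ge> 1"
  shows "real n * rec_poly h n x = x * (\<Sum>j=1..n. h j * rec_poly h (n - j) x)"
  using rec_poly_eq[OF assms, of h x] assms by simp

lemma lead_nonneg: "x \<ge> 0 \<Longrightarrow> lead x n \<ge> 0"
proof (induction n rule: less_induct)
  case (less n)
  show ?case
  proof (cases "n = 0")
    case False
    have "lead x n = x / real n * (\<Sum>j=1..n. if optimal j (n - j) then real j * lead x (n - j) else 0)"
      using False by (intro lead_eq) auto
    also have "\<dots> \<ge> 0"
      using less by (intro mult_nonneg_nonneg sum_nonneg) auto
    finally show ?thesis .
  qed simp
qed

lemma lead_rec_upto_4: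
  assumes "n \<ge> 4"
  shows "real n * lead x n = x * (\<Sum>j\<in>{1,2,3,4}. if optimal j (n - j) then real j * lead x (n - j) else 0)"
proof -
  have "(\<Sum>j=1..n. if optimal j (n - j) then real j * lead x (n - j) else 0) =
    (\<Sum>j\<in>{1,2,3,4}. if optimal j (n - j) then real j * lead x (n - j) else 0)"
    using assms by (intro sum.mono_neutral_right) (auto simp: optimal_def)
  then show ?thesis using assms by (simp add: lead_rec)
qed

lemma lead_small: "lead x 1 = x" "lead x 2 = x" "lead x 3 = x"
proof -
  show 1: "lead x 1 = x" using lead_rec[of 1 x] by (simp add: optimal_def)
  have s: "{1..2} = {1,2::nat}" "{1..3} = {1,2,3::nat}" by auto
  show "lead x 2 = x" using lead_rec[of 2 x] unfolding s by (simp add: optimal_def)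
  show "lead x 3 = x" using lead_rec[of 3 x] unfolding s by (simp add: optimal_def)
qed

text \<open>A partition with \<open>m_j\<close> parts equal to \<open>j\<close> contributes the
  product of \<open>x ^ m_j / fact m_j\<close>. The optimal ones are \<open>k\<close> threes, then
  these with one 2, then these with either one 4 or two 2s; the last two options give
  \<open>x + x\<^sup>2 / 2\<close>. The proof checks this against the recursion, all three residues
  at once.\<close>

lemma lead_closed:
  "lead x (3 * k) = x ^ k / fact k"
  "lead x (3 * k + 2) = x ^ (k + 1) / fact k"
  "lead x (3 * k + 4) = x ^ (k + 1) * (1 + x / 2) / fact k"
proof (induction k)
  case 0
  have "lead x 4 = x * (1 + x / 2)"
    using lead_rec_upto_4[of 4 x] by (simp add: optimal_def lead_small algebra_simps)
  {
    case 1 show ?case by simp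
  next
    case 2 show ?case using lead_small(2)[of x] by (simp only: mult_0_right add_0) simp
  next
    case 3 show ?case using \<open>lead x 4 = _\<close> by simp
  }
next
  case (Suc k)
  have m: "(3 * k + 4) mod 3 = 1" "(3 * k + 5) mod 3 = 2" "(3 * k + 3) mod 3 = 0"
    "(3 * k + 2) mod 3 = 2" "3 * k \<noteq> 1" by presburger+
  \<comment> \<open>With this common factor, all old and new values become polynomials in
    \<open>x\<close> and \<open>k\<close> times \<open>q\<close>.\<close>
  define q where "q = x ^ k / fact (k + 1)"
  have q: "x ^ k / fact k = (real k + 1) * q"
    by (simp add: q_def add.commute flip: of_nat_Suc)
  have 0: "lead x (3 * k + 3) = x ^ (k + 1) / fact (k + 1)"
  \<comment> \<open>The recursion restricted to parts up to 4 requires \<open>n \<ge> 4\<close>, so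
    \<open>lead x 3\<close> is taken from the small values.\<close>
  proof (cases "k = 0")
    case False
    then have "(3 * k - 1) mod 3 = 2" by (cases k) (simp_all, presburger)
    then have "real (3 * k + 3) * lead x (3 * k + 3) = x * (3 * lead x (3 * k))"
      using lead_rec_upto_4[of "3 * k + 3" x] False m by (simp add: optimal_def)
    then have "lead x (3 * k + 3) = x * lead x (3 * k) / (real k + 1)"
      by (simp add: field_simps)
    then show ?thesis unfolding Suc.IH by (simp add: field_simps)
  qed (simp add: lead_small)
  have IH: "lead x (3 * k + 2) = x * ((real k + 1) * q)"
      "lead x (3 * k + 4) = x * (1 + x / 2) * ((real k + 1) * q)"
    unfolding Suc.IH q[symmetric] by simp_all
  have 0: "lead x (3 * k + 3) = x * q" "x ^ (k + 1) / fact (k + 1) = x * q"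
    unfolding 0 q_def by simp_all
  have l2: "lead x (3 * k + 5) = x * x * q"
  proof -
    have "real (3 * k + 5) * lead x (3 * k + 5) = x * (2 * lead x (3 * k + 3) + 3 * lead x (3 * k + 2))"
      using lead_rec_upto_4[of "3 * k + 5" x] m by (simp add: optimal_def add.commute)
    also have "\<dots> = real (3 * k + 5) * (x * x * q)"
      unfolding 0 IH by (simp add: algebra_simps)
    finally show ?thesis by (simp del: of_nat_add of_nat_mult)
  qed
  have l4: "lead x (3 * k + 7) = x * x * (1 + x / 2) * q"
  proof -
    have "real (3 * k + 7) * lead x (3 * k + 7)
        = x * (2 * lead x (3 * k + 5) + 3 * lead x (3 * k + 4) + 4 * lead x (3 * k + 3))"
      using lead_rec_upto_4[of "3 * k + 7" x] m by (simp add: optimal_def add.commute)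
    also have "\<dots> = real (3 * k + 7) * (x * x * (1 + x / 2) * q)"
      unfolding 0 l2 IH by (simp add: algebra_simps)
    finally show ?thesis by (simp del: of_nat_add of_nat_mult)
  qed
  have e: "3 * Suc k = 3 * k + 3" "3 * k + 3 + 2 = 3 * k + 5" "3 * k + 3 + 4 = 3 * k + 7" by auto
  {
    case 1 show ?case unfolding e 0 by (simp add: q_def)
  next
    case 2 show ?case unfolding e l2 by (simp add: q_def)
  next
    case 3 show ?case unfolding e l4 by (simp add: q_def)
  }
qed

section \<open>Bounds for the recursively defined polynomials\<close>

lemma rec_poly_nonneg:
  assumes "\<And>j. j \<ge> 1 \<Longrightarrow> h j \<ge> 0" "x \<ge> 0"
  shows "rec_poly h n x \<ge> 0"
proof (induction n rule: less_induct)
  case (less n)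
  show ?case
  proof (cases "n = 0")
    case False
    have "rec_poly h n x = x / real n * (\<Sum>j=1..n. h j * rec_poly h (n - j) x)"
      using False by (intro rec_poly_eq) auto
    also have "\<dots> \<ge> 0"
      using less assms by (intro mult_nonneg_nonneg sum_nonneg) auto
    finally show ?thesis .
  qed simp
qed

lemma rec_poly_mono:
  assumes "\<And>j. j \<ge> 1 \<Longrightarrow> h j \<ge> 0" "\<And>j. j \<ge> 1 \<Longrightarrow> h j \<le> h' j" "x \<ge> 0"
  shows "rec_poly h n x \<le> rec_poly h' n x"
proof (induction n rule: less_induct)
  case (less n)
  have h': "h' j \<ge> 0" if "j \<ge> 1" for j using assms(1,2)[OF that] by linarith
  show ?case
  proof (cases "n = 0")
    case False
    have "x / real n * (\<Sum>j=1..n. h j * rec_poly h (n - j) x)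
      \<le> x / real n * (\<Sum>j=1..n. h' j * rec_poly h' (n - j) x)"
      using less assms h' by (intro mult_left_mono sum_mono mult_mono rec_poly_nonneg) auto
    then show ?thesis using False by (simp add: rec_poly_eq)
  qed simp
qed

text \<open>Only the optimal parts are kept in the recursion; for these
  \<open>j ^ D * max_prod (n - j) ^ D\<close> is exactly \<open>max_prod n ^ D\<close>, and what
  remains is the recursion of \<open>lead\<close>.\<close>

lemma rec_poly_lower:
  assumes "\<And>j. j \<ge> 1 \<Longrightarrow> real j ^ (D + 1) \<le> h j" "x \<ge> 0"
  shows "real (max_prod n) ^ D * lead x n \<le> rec_poly h n x"
proof (induction n rule: less_induct)
  case (less n)
  have h0: "h j \<ge> 0" if "j \<ge> 1" for j
    using assms(1)[OF that] by (rule order_trans[rotated]) simp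
  show ?case
  proof (cases "n = 0")
    case False
    then have n: "n \<ge> 1" by simp
    have "real n * (real (max_prod n) ^ D * lead x n) =
      x * (\<Sum>j=1..n. if optimal j (n - j) then real (max_prod n) ^ D * (real j * lead x (n - j)) else 0)"
      unfolding mult.left_commute[of "real n"] lead_rec[OF n, of x] mult.left_commute[of _ x]
      by (simp add: sum_distrib_left if_distrib cong: if_cong)
    also have "\<dots> \<le> x * (\<Sum>j=1..n. h j * rec_poly h (n - j) x)"
    proof (intro mult_left_mono sum_mono \<open>x \<ge> 0\<close>)
      fix j assume j: "j \<in> {1..n}"
      have hP: "0 \<le> h j * rec_poly h (n - j) x"
        using j h0 assms(2) by (intro mult_nonneg_nonneg rec_poly_nonneg) auto
      show "(if optimal j (n - j) then real (max_prod n) ^ D * (real j * lead x (n - j)) else 0)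
        \<le> h j * rec_poly h (n - j) x"
      proof (cases "optimal j (n - j)")
        case True
        then have "max_prod n = j * max_prod (n - j)" using max_prod_add[of j "n - j"] j by simp
        then have "real (max_prod n) ^ D * (real j * lead x (n - j))
          = real j ^ (D + 1) * (real (max_prod (n - j)) ^ D * lead x (n - j))"
          by (simp add: power_mult_distrib)
        also have "\<dots> \<le> h j * rec_poly h (n - j) x"
          using j less.IH[of "n - j"] assms h0
          by (intro mult_mono) (auto intro!: mult_nonneg_nonneg lead_nonneg)
        finally show ?thesis using True by simp
      qed (use hP in simp)
    qed
    also have "\<dots> = real n * rec_poly h n x" using rec_poly_rec[OF n] by simp
    finally show ?thesis using n by simp
  qed simp
qed

text \<open>This is the case \<open>D = 0\<close> of the lower bound: \<open>rec_poly real\<close>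
  is the total weight of all compositions, optimal or not.\<close>

lemma lead_le_rec_poly: "x \<ge> 0 \<Longrightarrow> lead x n \<le> rec_poly real n x"
  using rec_poly_lower[of 0 real x n] by simp

text \<open>A part \<open>j\<close> is charged either \<open>j ^ D\<close>, where a non-maximal product costs a factor \<open>\<delta>\<close>, or
  \<open>a j * (j - 1) ^ D\<close>, where even the remaining composition of \<open>n - 1\<close> costs a factor \<open>\<eta>\<close>. Keeping
  these errors apart, so that \<open>a\<close> enters only with \<open>\<eta>\<close>, is essential for small \<open>n\<close> and small \<open>x\<close>.
  Only parts \<open>j \<ge> 2\<close> can be charged in the second way, whence the exponent \<open>n div 2\<close>.\<close>

lemma rec_poly_upper:
  fixes h a :: "nat \<Rightarrow> real"
  assumes h: "\<And>j. j \<ge> 1 \<Longrightarrow> 0 \<le> h j" "\<And>j. j \<ge> 1 \<Longrightarrow> h j \<le> real j ^ (D + 1) + a j * (real j - 1) ^ D"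
    and a: "\<And>j. j \<ge> 1 \<Longrightarrow> real j \<le> a j" and "D \<ge> 1" "x \<ge> 0"
  defines "\<delta> \<equiv> (8 / 9 :: real) ^ D" and "\<eta> \<equiv> (3 / 4 :: real) ^ D"
  shows "rec_poly h n x \<le> real (max_prod n) ^ D *
    ((1 - \<delta>) * lead x n + \<delta> * rec_poly real n x + ((1 + \<eta>) ^ (n div 2) - 1) * rec_poly a n x)"
proof (induction n rule: less_induct)
  case (less n)
  define E where "E m = (1 + \<eta>) ^ (m div 2)" for m
  define B where "B m = (1 - \<delta>) * lead x m + \<delta> * rec_poly real m x + (E m - 1) * rec_poly a m x" for m
  have \<delta>: "0 \<le> \<delta>" "\<delta> \<le> 1" and \<eta>: "0 \<le> \<eta>" by (auto simp: \<delta>_def \<eta>_def power_le_one)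
  have E: "E m \<ge> 1" for m using \<eta> by (simp add: E_def)
  have E_mono: "E m \<le> E m'" if "m \<le> m'" for m m'
    unfolding E_def using \<eta> that by (intro power_increasing) (auto simp: div_le_mono)
  have L0: "0 \<le> lead x m" for m using \<open>x \<ge> 0\<close> by (rule lead_nonneg)
  have LQ: "lead x m \<le> rec_poly real m x" for m using \<open>x \<ge> 0\<close> by (rule lead_le_rec_poly)
  have QA: "rec_poly real m x \<le> rec_poly a m x" for m
    using a \<open>x \<ge> 0\<close> by (intro rec_poly_mono) auto
  have Q0: "0 \<le> rec_poly real m x" for m using L0 LQ order_trans by blast
  have A0: "0 \<le> rec_poly a m x" for m using Q0 QA order_trans by blast
  have BQ: "B m \<le> rec_poly real m x + (E m - 1) * rec_poly a m x" for m
    using mult_left_mono[OF LQ, of "1 - \<delta>" m] \<delta> by (simp add: B_def algebra_simps)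
  have BA: "B m \<le> E m * rec_poly a m x" for m
    using BQ[of m] QA[of m] by (simp add: algebra_simps)
  have B0: "0 \<le> B m" for m
    unfolding B_def using \<delta> L0 Q0 A0 E by (intro add_nonneg_nonneg mult_nonneg_nonneg) auto
  show ?case
  proof (cases "n = 0")
    case False
    then have n: "n \<ge> 1" by simp
    define M where "M = real (max_prod n) ^ D"
    have M: "M \<ge> 0" by (simp add: M_def)
    have summand: "h j * rec_poly h (n - j) x \<le> M * ((1 - \<delta>) * (if optimal j (n - j) then real j * lead x (n - j) else 0)
        + \<delta> * (real j * rec_poly real (n - j) x) + (E n - 1) * (a j * rec_poly a (n - j) x))"
      if j: "j \<in> {1..n}" for j
    proof -
      define m where "m = n - j"
      have nm: "n = m + j" using j by (simp add: m_def)
      define N where "N = real (max_prod m) ^ D"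
      have N: "N \<ge> 0" by (simp add: N_def)
      have j1: "j \<ge> 1" using j by simp
      have aj: "real j \<le> a j" "0 \<le> a j" using a[OF j1] by auto
      have "h j * rec_poly h m x \<le> (real j ^ (D + 1) + a j * (real j - 1) ^ D) * (N * B m)"
        using h j1 less.IH[of m] j B0[of m] N aj
        by (intro mult_mono) (auto simp: B_def N_def E_def m_def intro!: rec_poly_nonneg h \<open>x \<ge> 0\<close>)
      also have "\<dots> = real j * ((real j ^ D * N) * B m) + a j * (((real j - 1) ^ D * N) * B m)"
        by (simp add: algebra_simps)
      finally have s0: "h j * rec_poly h m x
        \<le> real j * ((real j ^ D * N) * B m) + a j * (((real j - 1) ^ D * N) * B m)" .
      have s1: "real j * ((real j ^ D * N) * B m) \<le> M * ((1 - \<delta>) * (if optimal j m then real j * lead x m else 0)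
        + \<delta> * (real j * rec_poly real m x) + (E m - 1) * (real j * rec_poly a m x))"
      proof (cases "optimal j m")
        case True
        then have "real j ^ D * N = M"
          using max_prod_add[OF j1, of m] by (simp add: N_def M_def nm flip: power_mult_distrib of_nat_mult)
        with True show ?thesis by (simp add: B_def algebra_simps)
      next
        case False
        then have "9 * (real j * real (max_prod m)) \<le> 8 * real (max_prod n)"
          using max_prod_add[OF j1, of m] unfolding nm by (simp flip: of_nat_mult of_nat_le_iff)
        then have "(real j * real (max_prod m)) ^ D \<le> (8 / 9 * real (max_prod n)) ^ D"
          by (intro power_mono) auto
        then have "real j ^ D * N \<le> \<delta> * M"
          unfolding \<delta>_def N_def M_def power_mult_distrib .
        then have "(real j ^ D * N) * B m \<le> (\<delta> * M) * (rec_poly real m x + (E m - 1) * rec_poly a m x)"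
          using BQ B0 \<delta> M by (intro mult_mono[of "_ * N"]) auto
        also have "\<dots> = M * (\<delta> * rec_poly real m x + \<delta> * ((E m - 1) * rec_poly a m x))"
          by (simp add: algebra_simps)
        \<comment> \<open>The factor \<open>\<delta>\<close> on the second error is given up, so
          that this error has the same form for optimal and non-optimal parts.\<close>
        also have "\<dots> \<le> M * (\<delta> * rec_poly real m x + 1 * ((E m - 1) * rec_poly a m x))"
          using \<delta> E A0 M by (intro mult_left_mono add_left_mono mult_right_mono) auto
        finally have "real j * ((real j ^ D * N) * B m) \<le> real j * (M * (\<delta> * rec_poly real m x + (E m - 1) * rec_poly a m x))"
          by (intro mult_left_mono) auto
        with False show ?thesis by (simp add: algebra_simps)
      qed
      have s2: "a j * (((real j - 1) ^ D * N) * B m) \<le> M * ((E n - E m) * (a j * rec_poly a m x))"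
      proof (cases "j = 1")
        \<comment> \<open>A part 1 has no error of the second kind: \<open>(j - 1) ^ D\<close>
          vanishes because \<open>D \<ge> 1\<close>.\<close>
        case True
        then show ?thesis using \<open>D \<ge> 1\<close> M E_mono[of m n] aj A0 nm
          by (auto intro!: mult_nonneg_nonneg simp: zero_power)
      next
        case False
        then have j2: "j \<ge> 2" using j1 by simp
        have "4 * (real (j - 1) * real (max_prod m)) \<le> 3 * real (max_prod n)"
          using max_prod_pred_part[OF j2, of m] unfolding nm by (simp flip: of_nat_mult of_nat_le_iff)
        then have "((real j - 1) * real (max_prod m)) ^ D \<le> (3 / 4 * real (max_prod n)) ^ D"
          using j2 by (intro power_mono) (auto simp: of_nat_diff)
        then have "(real j - 1) ^ D * N \<le> \<eta> * M"
          unfolding \<eta>_def N_def M_def power_mult_distrib .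
        then have "((real j - 1) ^ D * N) * B m \<le> (\<eta> * M) * (E m * rec_poly a m x)"
          using BA B0 \<eta> M by (intro mult_mono[of "_ * N"]) auto
        also have "\<dots> = M * ((\<eta> * E m) * rec_poly a m x)" by simp
        also have "\<dots> \<le> M * ((E n - E m) * rec_poly a m x)"
        proof (intro mult_left_mono mult_right_mono A0 M)
          \<comment> \<open>Two more units raise \<open>div 2\<close> by one, and
            \<open>j \<ge> 2\<close> supplies them.\<close>
          have "E m * (1 + \<eta>) = E (m + 2)" by (simp add: E_def)
          also have "\<dots> \<le> E n" using j2 nm by (intro E_mono) auto
          finally show "\<eta> * E m \<le> E n - E m" by (simp add: algebra_simps)
        qed
        finally have "a j * (((real j - 1) ^ D * N) * B m) \<le> a j * (M * ((E n - E m) * rec_poly a m x))"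
          using aj by (intro mult_left_mono) auto
        then show ?thesis by (simp add: algebra_simps)
      qed
      \<comment> \<open>Once \<open>j\<close> is replaced by \<open>a j\<close>, the two errors
        telescope: \<open>(E m - 1) + (E n - E m) = E n - 1\<close>.\<close>
      have "M * ((E m - 1) * (real j * rec_poly a m x)) \<le> M * ((E m - 1) * (a j * rec_poly a m x))"
        using E aj A0 M by (intro mult_left_mono mult_right_mono) auto
      with s0 s1 s2 show ?thesis
        unfolding m_def[symmetric] by (simp only: distrib_left left_diff_distrib right_diff_distrib)
    qed
    have "real n * rec_poly h n x = x * (\<Sum>j=1..n. h j * rec_poly h (n - j) x)"
      by (rule rec_poly_rec[OF n])
    also have "\<dots> \<le> x * (\<Sum>j=1..n. M * ((1 - \<delta>) * (if optimal j (n - j) then real j * lead x (n - j) else 0)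
        + \<delta> * (real j * rec_poly real (n - j) x) + (E n - 1) * (a j * rec_poly a (n - j) x)))"
      using summand \<open>x \<ge> 0\<close> by (intro mult_left_mono sum_mono) auto
    \<comment> \<open>The three sums are the recursions of \<open>lead\<close>,
      \<open>rec_poly real\<close> and \<open>rec_poly a\<close>, which restores the shape of
      \<open>B n\<close>.\<close>
    also have "\<dots> = M * ((1 - \<delta>) * (x * (\<Sum>j=1..n. if optimal j (n - j) then real j * lead x (n - j) else 0))
        + \<delta> * (x * (\<Sum>j=1..n. real j * rec_poly real (n - j) x))
        + (E n - 1) * (x * (\<Sum>j=1..n. a j * rec_poly a (n - j) x)))"
      unfolding sum_distrib_left[symmetric] sum.distrib by (simp only: distrib_left mult.left_commute[of x])
    also have "\<dots> = real n * (M * B n)"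
      unfolding lead_rec[OF n, symmetric] rec_poly_rec[OF n, symmetric] B_def by (simp add: algebra_simps)
    finally show ?thesis using n by (simp add: M_def B_def E_def)
  qed simp
qed

section \<open>Auxiliary inequalities\<close>

text \<open>Replacing each \<open>j\<close> by \<open>n\<close> leaves the sum of all earlier
  values, which by induction is at most 1 plus a geometric sum.\<close>

lemma rec_poly_real_le:
  assumes "x \<ge> 0" "n \<ge> 1"
  shows "rec_poly real n x \<le> x * (1 + x) ^ (n - 1)"
  using assms(2)
proof (induction n rule: less_induct)
  case (less n)
  have "(\<Sum>j=1..n. real j * rec_poly real (n - j) x) \<le> real n * (1 + x) ^ (n - 1)"
  proof -
    have "(\<Sum>j=1..n. real j * rec_poly real (n - j) x) \<le> (\<Sum>j=1..n. real n * rec_poly real (n - j) x)"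
      using assms by (intro sum_mono mult_right_mono rec_poly_nonneg) auto
    also have "\<dots> = real n * (\<Sum>i<n. rec_poly real i x)"
      unfolding sum_distrib_left[symmetric]
      by (intro arg_cong2[where f = "(*)"] refl sum.reindex_bij_witness[of _ "\<lambda>i. n - i" "\<lambda>j. n - j"]) auto
    also have "(\<Sum>i<n. rec_poly real i x) = 1 + (\<Sum>i<n - 1. rec_poly real (Suc i) x)"
      using sum.lessThan_Suc_shift[of "\<lambda>i. rec_poly real i x" "n - 1"] less.prems by simp
    also have "(\<Sum>i<n - 1. rec_poly real (Suc i) x) \<le> (\<Sum>i<n - 1. x * (1 + x) ^ i)"
    proof (intro sum_mono)
      show "rec_poly real (Suc i) x \<le> x * (1 + x) ^ i" if "i \<in> {..<n - 1}" for i
        using less.IH[of "Suc i"] that by simp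
    qed
    also have "(\<Sum>i<n - 1. x * (1 + x) ^ i) = (1 + x) ^ (n - 1) - 1"
      using power_diff_1_eq[of "1 + x" "n - 1"] by (simp add: sum_distrib_left)
    finally show ?thesis by (simp add: mult_left_mono)
  qed
  then have "x * (\<Sum>j=1..n. real j * rec_poly real (n - j) x) \<le> x * (real n * (1 + x) ^ (n - 1))"
    using \<open>x \<ge> 0\<close> by (rule mult_left_mono)
  then have "real n * rec_poly real n x \<le> real n * (x * (1 + x) ^ (n - 1))"
    by (simp only: rec_poly_rec[OF less.prems] mult.left_commute)
  then show ?case using less.prems by simp
qed

text \<open>At the point 1 the terms do not tend to 0. Applied to \<open>g 1 m / m \<ge> 1\<close>,
  this yields \<open>r \<le> 1\<close>.\<close>

lemma conv_radius_le_one: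
  fixes a :: "nat \<Rightarrow> real"
  assumes "\<And>m. m \<ge> 1 \<Longrightarrow> a m \<ge> 1"
  shows "conv_radius a \<le> 1"
proof (rule ccontr)
  assume "\<not> conv_radius a \<le> 1"
  then have "summable (\<lambda>n. a n * 1 ^ n)"
    by (intro summable_in_conv_radius) (auto simp: one_ereal_def)
  then have "a \<longlonglongrightarrow> 0" using summable_LIMSEQ_zero by simp
  then have "eventually (\<lambda>m. a m < 1) sequentially" by (rule order_tendstoD) simp
  then obtain N where "\<And>m. m \<ge> N \<Longrightarrow> a m < 1" by (auto simp: eventually_sequentially)
  then have "a (max N 1) < 1" by simp
  with assms[of "max N 1"] show False by simp
qed

lemma rec_poly_real_small:
  "rec_poly real 1 x = x"
  "rec_poly real 2 x = x + x ^ 2 / 2"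
  "rec_poly real 3 x = x + x ^ 2 + x ^ 3 / 6"
  "rec_poly real 4 x = x + 3 / 2 * x ^ 2 + x ^ 3 / 2 + x ^ 4 / 24"
proof -
  have s: "{1..2} = {1,2::nat}" "{1..3} = {1,2,3::nat}" "{1..4} = {1,2,3,4::nat}" by auto
  show 1: "rec_poly real 1 x = x" by (subst rec_poly_eq) simp_all
  show 2: "rec_poly real 2 x = x + x ^ 2 / 2"
    using rec_poly_eq[of 2 real x] 1 unfolding s by (simp add: field_simps power2_eq_square)
  show 3: "rec_poly real 3 x = x + x ^ 2 + x ^ 3 / 6"
    using rec_poly_eq[of 3 real x] 1 2 unfolding s by (simp add: field_simps power2_eq_square power3_eq_cube)
  show "rec_poly real 4 x = x + 3 / 2 * x ^ 2 + x ^ 3 / 2 + x ^ 4 / 24"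
    using rec_poly_eq[of 4 real x] 1 2 3 unfolding s
    by (simp add: field_simps power2_eq_square power3_eq_cube power4_eq_xxxx)
qed

text \<open>Induction on \<open>k\<close> with \<open>(1 + 1 / k) ^ k \<ge> 2\<close>, which is
  Bernoulli's inequality.\<close>

lemma fact_le_self_power: "fact k * 2 ^ (k - 1) \<le> real k ^ k"
proof (induction k)
  case (Suc k)
  show ?case
  proof (cases "k = 0")
    case False
    have "2 * real k ^ k \<le> (1 + real k) ^ k"
    proof -
      have "2 \<le> (1 + 1 / real k) ^ k"
        using Bernoulli_inequality[OF order_trans[of "-1" 0 "1 / real k"], of k] False by simp
      then have "2 * real k ^ k \<le> (1 + 1 / real k) ^ k * real k ^ k"
        by (intro mult_right_mono) auto
      also have "\<dots> = (1 + real k) ^ k"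
        using False by (simp add: field_simps flip: power_mult_distrib)
      finally show ?thesis .
    qed
    moreover have "(2::real) ^ k = 2 * 2 ^ (k - 1)"
      using False by (cases k) auto
    ultimately have "fact k * 2 ^ k \<le> (1 + real k) ^ k"
      using Suc.IH by simp
    then have "(1 + real k) * (fact k * 2 ^ k) \<le> (1 + real k) * (1 + real k) ^ k"
      by (intro mult_left_mono) auto
    then show ?thesis by (simp add: algebra_simps)
  qed simp
qed simp

lemma power_one_plus_le:
  fixes \<eta> :: real
  assumes "0 \<le> \<eta>" "real m * \<eta> \<le> 1"
  shows "(1 + \<eta>) ^ (m div 2) - 1 \<le> real m * \<eta>"
proof -
  define t where "t = real (m div 2) * \<eta>"
  have "real (m div 2) \<le> real m / 2" by linarith
  then have "t \<le> real m / 2 * \<eta>"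
    unfolding t_def using assms by (intro mult_right_mono) auto
  then have t: "0 \<le> t" "2 * t \<le> real m * \<eta>" "t \<le> 1" using assms by (auto simp: t_def)
  have "(1 + \<eta>) ^ (m div 2) \<le> exp \<eta> ^ (m div 2)"
    using assms by (intro power_mono) auto
  also have "\<dots> = exp t" by (simp add: t_def exp_of_nat_mult)
  also have "\<dots> \<le> 1 + t + t\<^sup>2" using t by (intro exp_bound) auto
  also have "t\<^sup>2 \<le> t" using t by (simp add: power2_eq_square mult_left_le)
  finally show ?thesis using t by simp
qed

lemma nine_eighths_power: "(9 / 8 :: real) ^ D * (8 / 9) ^ D = 1"
  by (simp flip: power_mult_distrib)

text \<open>Everything follows from \<open>x * z = inverse r ^ 3\<close>: the first bound from
  \<open>r \<le> 1\<close>, the second from the polynomial of index 3 divided by \<open>x\<close>.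
  The absolute bound combines the first, for small \<open>x\<close>, with the polynomial of index
  4.\<close>

lemma scale_ge:
  fixes x r :: real
  assumes x_pos: "x > 0" and "0 < r" "r \<le> 1" and Q: "\<And>m. rec_poly real m x \<le> inverse r ^ m"
  defines "z \<equiv> inverse (x * r ^ 3)"
  shows "1 \<le> x * z" "1 + x + x\<^sup>2 / 6 \<le> z" "93 / 50 \<le> z"
proof -
  have xz: "x * z = inverse r ^ 3"
    using assms by (simp add: z_def field_simps)
  show 1: "1 \<le> x * z" unfolding xz using assms by (simp add: one_le_inverse)
  have z0: "z > 0" using assms by (simp add: z_def)
  have "x * (1 + x + x\<^sup>2 / 6) \<le> x * z"
    using Q[of 3] unfolding xz rec_poly_real_small by (simp add: algebra_simps eval_nat_numeral)
  then show 2: "1 + x + x\<^sup>2 / 6 \<le> z" using assms by simp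
  show "93 / 50 \<le> z"
  proof (cases "x \<le> 53 / 100")
    case True
    have "x * z \<le> 53 / 100 * z" using True z0 by (intro mult_right_mono) auto
    with 1 show ?thesis by simp
  next
    case False
    \<comment> \<open>The polynomial of index 4 divided by \<open>x\<close>, without its top
      term.\<close>
    define b where "b = 1 + 3 / 2 * x + x\<^sup>2 / 2"
    have b: "b > 0" using assms by (auto simp: b_def intro: add_pos_nonneg)
    have "x * b \<le> rec_poly real 4 x"
      using x_pos unfolding rec_poly_real_small b_def by (simp add: algebra_simps eval_nat_numeral)
    also note Q[of 4]
    finally have "x * b \<le> inverse r ^ 4" .
    then have "(x * b) ^ 3 \<le> (inverse r ^ 4) ^ 3"
      using assms b by (intro power_mono) auto
    also have "\<dots> = (x * z) ^ 4" unfolding xz by (simp flip: power_mult)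
    finally have "x ^ 3 * b ^ 3 \<le> x ^ 3 * (x * z ^ 4)"
      by (simp add: power_mult_distrib algebra_simps eval_nat_numeral)
    then have "b ^ 3 \<le> x * z ^ 4" using assms by simp
    \<comment> \<open>The tangent of \<open>b ^ 3\<close> at 21/10 lies below the cube for positive
      \<open>b\<close>.\<close>
    moreover have "0 \<le> (b - 21 / 10)\<^sup>2 * (b + 42 / 10)" using b by simp
    then have "1323 / 100 * b - 18522 / 1000 \<le> b ^ 3"
      by (simp add: eval_nat_numeral field_simps)
    moreover have "12 * x \<le> 1323 / 100 * b - 18522 / 1000"
    proof -
      have "53 / 100 * x \<le> x * x" using False assms by (intro mult_right_mono) auto
      then have "3 / 2 * x + 53 / 100 * x / 2 + 1 \<le> b" unfolding b_def power2_eq_square by simp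
      then show ?thesis using False by linarith
    qed
    ultimately have "x * 12 \<le> x * z ^ 4" by linarith
    then have "12 \<le> z ^ 4" using assms by simp
    show ?thesis
    proof (rule ccontr)
      \<comment> \<open>The value 93/50 lies just below the fourth root of 12.\<close>
      assume "\<not> 93 / 50 \<le> z"
      then have "z ^ 4 \<le> (93 / 50) ^ 4" using z0 by (intro power_mono) auto
      also have "\<dots> < 12" by (simp add: eval_nat_numeral)
      finally show False using \<open>12 \<le> z ^ 4\<close> by simp
    qed
  qed
qed

lemma nine_eighths_exponent_ge:
  assumes "(9 / 8 :: real) ^ N < (9 / 8) ^ D"
  shows "N + 1 \<le> D"
  using assms power_less_imp_less_exp[of "9 / 8 :: real" N D] by simp

section \<open>The sign of Delta\<close>

text \<open>The setting for one fixed \<open>x\<close> and \<open>d\<close>: \<open>h\<close> is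
  \<open>g d\<close>, \<open>a\<close> is \<open>g 1\<close>, \<open>D\<close> is
  \<open>d - 1\<close> and \<open>r\<close> is the value \<open>r x\<close>.\<close>

locale perturbed_powers =
  fixes h a :: "nat \<Rightarrow> real" and D :: nat and x r :: real
  assumes h_lower: "\<And>j. j \<ge> 1 \<Longrightarrow> real j ^ (D + 1) \<le> h j"
    and h_upper: "\<And>j. j \<ge> 1 \<Longrightarrow> h j \<le> real j ^ (D + 1) + a j * (real j - 1) ^ D"
    and a_ge: "\<And>j. j \<ge> 1 \<Longrightarrow> real j \<le> a j"
    and x_pos: "x > 0" and r_pos: "r > 0" and r_le_1: "r \<le> 1"
    and a_bound: "\<And>m. rec_poly a m x \<le> inverse r ^ m"
begin

text \<open>\<open>\<delta>\<close> is the loss of a non-maximal product and \<open>\<eta>\<close>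
  the loss from lowering a part by one. The scale \<open>z\<close> is chosen so that
  \<open>ln (k * z)\<close> is the bracket in the thresholds for the residues 0 and 1.\<close>

definition \<delta> :: real where "\<delta> = (8 / 9) ^ D"
definition \<eta> :: real where "\<eta> = (3 / 4) ^ D"
definition z :: real where "z = inverse (x * r ^ 3)"

lemma real_bound: "rec_poly real m x \<le> inverse r ^ m"
proof -
  have "rec_poly real m x \<le> rec_poly a m x"
    using a_ge x_pos by (intro rec_poly_mono) auto
  also note a_bound
  finally show ?thesis .
qed

lemmas z_ge = scale_ge[OF x_pos r_pos r_le_1 real_bound, folded z_def]

lemma z_pos: "z > 0" using z_ge(3) by linarith

lemma inverse_r_3: "inverse r ^ 3 = x * z"
  using x_pos r_pos by (simp add: z_def field_simps)

lemma inverse_r_le: "inverse r \<le> x * z"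
proof -
  have "inverse r ^ 1 \<le> inverse r ^ 3"
    using r_pos r_le_1 by (intro power_increasing) (auto simp: one_le_inverse)
  then show ?thesis using inverse_r_3 by simp
qed

lemma delta: "0 < \<delta>" "\<delta> \<le> 1" "(9 / 8) ^ D * \<delta> = 1"
  using nine_eighths_power[of D] by (auto simp: \<delta>_def power_le_one)

text \<open>The second bound rests on 3/4 < 64/81, the square of 8/9.\<close>

lemma eta: "0 \<le> \<eta>" "\<eta> \<le> \<delta>\<^sup>2"
proof -
  show "0 \<le> \<eta>" by (simp add: \<eta>_def)
  have "\<eta> \<le> ((8 / 9)\<^sup>2) ^ D" unfolding \<eta>_def by (intro power_mono) (auto simp: eval_nat_numeral)
  then show "\<eta> \<le> \<delta>\<^sup>2" by (simp only: \<delta>_def power_mult[symmetric] mult.commute)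
qed

lemma P_nonneg: "rec_poly h n x \<ge> 0"
proof (rule rec_poly_nonneg)
  show "h j \<ge> 0" if "j \<ge> 1" for j
    using h_lower[OF that] by (rule order_trans[rotated]) simp
qed (use x_pos in simp)

lemma P_lower: "real (max_prod n) ^ D * lead x n \<le> rec_poly h n x"
  using rec_poly_lower[of D h x n] h_lower x_pos by simp

lemma P_upper:
  assumes "D \<ge> 1"
  shows "rec_poly h n x \<le> real (max_prod n) ^ D *
    ((1 - \<delta>) * lead x n + \<delta> * rec_poly real n x + ((1 + \<eta>) ^ (n div 2) - 1) * inverse r ^ n)"
proof -
  have "rec_poly h n x \<le> real (max_prod n) ^ D *
    ((1 - \<delta>) * lead x n + \<delta> * rec_poly real n x + ((1 + \<eta>) ^ (n div 2) - 1) * rec_poly a n x)"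
    unfolding \<delta>_def \<eta>_def
  proof (rule rec_poly_upper)
    show "h j \<ge> 0" if "j \<ge> 1" for j
      using h_lower[OF that] by (rule order_trans[rotated]) simp
  qed (use assms h_upper a_ge x_pos in auto)
  also have "\<dots> \<le> real (max_prod n) ^ D *
    ((1 - \<delta>) * lead x n + \<delta> * rec_poly real n x + ((1 + \<eta>) ^ (n div 2) - 1) * inverse r ^ n)"
    using a_bound eta(1) by (intro mult_left_mono add_left_mono) auto
  finally show ?thesis .
qed

text \<open>If \<open>n * \<delta> \<le> 1\<close>, then
  \<open>n * \<eta> \<le> n * \<delta>\<^sup>2 \<le> \<delta>\<close>, so each of the two errors is
  at most \<open>\<delta> * inverse r ^ n\<close>.\<close>

lemma P_upper_crude:
  assumes "D \<ge> 1" "real n * \<delta> \<le> 1"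
  shows "rec_poly h n x \<le> real (max_prod n) ^ D * (lead x n + 2 * \<delta> * inverse r ^ n)"
proof -
  have n\<eta>: "real n * \<eta> \<le> \<delta>"
  proof -
    have "real n * \<eta> \<le> real n * \<delta>\<^sup>2" using eta by (intro mult_left_mono) auto
    also have "\<dots> = (real n * \<delta>) * \<delta>" by (simp add: power2_eq_square)
    also have "\<dots> \<le> 1 * \<delta>" using assms delta by (intro mult_right_mono) auto
    finally show ?thesis by simp
  qed
  have "(1 + \<eta>) ^ (n div 2) - 1 \<le> \<delta>"
    using power_one_plus_le[of \<eta> n] eta n\<eta> delta by linarith
  then have "((1 + \<eta>) ^ (n div 2) - 1) * inverse r ^ n \<le> \<delta> * inverse r ^ n"
    using r_pos by (intro mult_right_mono) auto
  moreover have "\<delta> * rec_poly real n x \<le> \<delta> * inverse r ^ n"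
    using delta real_bound by (intro mult_left_mono) auto
  moreover have "(1 - \<delta>) * lead x n \<le> lead x n"
    using delta x_pos lead_nonneg[of x n] by (simp add: algebra_simps)
  ultimately have "(1 - \<delta>) * lead x n + \<delta> * rec_poly real n x + ((1 + \<eta>) ^ (n div 2) - 1) * inverse r ^ n
    \<le> lead x n + 2 * \<delta> * inverse r ^ n" by linarith
  then have "real (max_prod n) ^ D * ((1 - \<delta>) * lead x n + \<delta> * rec_poly real n x
      + ((1 + \<eta>) ^ (n div 2) - 1) * inverse r ^ n)
    \<le> real (max_prod n) ^ D * (lead x n + 2 * \<delta> * inverse r ^ n)"
    by (intro mult_left_mono) auto
  with P_upper[OF assms(1), of n] show ?thesis by linarith
qed

section \<open>Residues 0 and 1: neighbours of a multiple of 3, for k at least 2\<close>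

text \<open>This is \<open>lead x (3 * k)\<close>; it serves as the unit in which the neighbouring
  polynomials are measured.\<close>

definition w :: "nat \<Rightarrow> real" where "w k = x ^ k / fact k"

lemma w_pos: "w k > 0" using x_pos by (simp add: w_def)

lemma w_Suc: "x ^ (i + 1) / fact i = real (i + 1) * w (i + 1)"
  by (simp add: w_def flip: of_nat_Suc)

lemma inverse_r_3k: "inverse r ^ (3 * k) = (x * z) ^ k"
  by (simp only: power_mult inverse_r_3)

lemma inverse_r_power:
  assumes "k \<ge> 1"
  shows "inverse r ^ (3 * k) \<le> w k * (real k * z) ^ k"
proof -
  have "fact k * 1 \<le> fact k * (2::real) ^ (k - 1)" by (intro mult_left_mono) auto
  with fact_le_self_power[of k] have "fact k \<le> real k ^ k" by linarith
  then have "1 \<le> real k ^ k / fact k" by simp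
  then have "(x * z) ^ k * 1 \<le> (x * z) ^ k * (real k ^ k / fact k)"
    using x_pos z_pos by (intro mult_left_mono) auto
  then show ?thesis
    unfolding inverse_r_3k by (simp add: w_def power_mult_distrib mult_ac)
qed

text \<open>With \<open>y = k * z\<close>, the threshold says
  \<open>\<delta> * y ^ (2 * k) \<le> 1\<close>, while
  \<open>inverse r ^ (3 * k) \<le> w k * y ^ k\<close>. Hence the errors at
  \<open>3 * i + 2 = 3 * k - 1\<close> and \<open>3 * i + 4 = 3 * k + 1\<close> are small multiples
  of \<open>w k\<close>. The last two claims are the coefficient comparisons that decide the sign of
  \<open>Delta\<close>.\<close>

lemma estimates_k_ge_2:
  assumes k: "k = i + 1" "k \<ge> 2" and T: "(real k * z) ^ (2 * k) \<le> (9 / 8) ^ D"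
  shows "D \<ge> 1"
    and "rec_poly h (3 * i + 2) x \<le> (2 * 3 ^ i) ^ D * (w k * (real k + 2))"
    and "rec_poly h (3 * i + 4) x \<le> (4 * 3 ^ i) ^ D * (w k * ((real k + 2) * (1 + x)))"
    and "(real k + 2)\<^sup>2 * (1 + x) \<le> (9 / 8) ^ D"
    and "((real k + 2) * (1 + x))\<^sup>2 < x * (9 / 8) ^ D"
proof -
  define y where "y = real k * z"
  have y: "y \<ge> 93 / 50 * real k" "y \<ge> real k * (1 + x)" "x * y \<ge> real k"
  proof -
    show "y \<ge> 93 / 50 * real k" using mult_left_mono[OF z_ge(3), of "real k"] by (simp add: y_def)
    have "1 + x \<le> z" using z_ge(2) zero_le_power2[of x] by linarith
    then show "y \<ge> real k * (1 + x)" unfolding y_def by (intro mult_left_mono) auto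
    show "x * y \<ge> real k" using mult_left_mono[OF z_ge(1), of "real k"] by (simp add: y_def mult_ac)
  qed
  have k2: "real k \<ge> 2" using k by simp
  have y1: "y \<ge> 1" using y(1) k2 by linarith
  have "y ^ 4 \<le> y ^ (2 * k)" using y1 k by (intro power_increasing) auto
  then have T4: "y ^ 4 \<le> (9 / 8) ^ D" using T by (simp add: y_def)
  have k22: "real k + 2 \<le> real k * real k"
    using mult_right_mono[OF k2, of "real k"] k2 by linarith
  \<comment> \<open>Two different lower bounds for \<open>y\<close> are multiplied; 93/50 exceeds
    3/2, and this surplus later makes an inequality strict.\<close>
  have yy: "3 / 2 * ((real k + 2) * (1 + x)) \<le> y * y"
  proof -
    have "(real k + 2) * (1 + x) \<le> (real k * real k) * (1 + x)"
      using k22 x_pos by (intro mult_right_mono) auto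
    moreover have "(93 / 50 * real k) * (real k * (1 + x)) \<le> y * y"
      using y y1 x_pos by (intro mult_mono) auto
    moreover have "0 \<le> (real k * real k) * (1 + x)" using x_pos by simp
    ultimately show ?thesis by (simp add: mult.assoc)
  qed
  have kx: "0 < (real k + 2) * (1 + x)" using x_pos by simp
  show i: "(real k + 2)\<^sup>2 * (1 + x) \<le> (9 / 8) ^ D"
  proof -
    have "(real k + 2)\<^sup>2 * (1 + x) \<le> ((real k + 2) * (1 + x))\<^sup>2"
      using x_pos by (simp add: power_mult_distrib power2_eq_square mult_left_mono)
    also have "\<dots> \<le> (y * y)\<^sup>2" using yy kx by (intro power_mono) auto
    also have "\<dots> = y ^ 4" by (simp add: eval_nat_numeral)
    finally show ?thesis using T4 by linarith
  qed
  show "((real k + 2) * (1 + x))\<^sup>2 < x * (9 / 8) ^ D"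
  proof -
    have "((real k + 2) * (1 + x))\<^sup>2 = ((real k + 2) * (1 + x)) * ((real k + 2) * (1 + x))"
      by (simp add: power2_eq_square)
    also have "\<dots> < (y * y) * ((real k + 2) * (1 + x))"
      using yy kx by (intro mult_strict_right_mono) auto
    \<comment> \<open>Here one bound for \<open>y\<close> is replaced by
      \<open>x * y \<ge> k\<close>, which produces the factor \<open>x\<close> of the claim.\<close>
    also have "(real k + 2) * (1 + x) \<le> (x * y) * y"
    proof -
      have "real k + 2 \<le> real k * real k" by (rule k22)
      then have "(real k + 2) * (1 + x) \<le> (real k * real k) * (1 + x)"
        using x_pos by (intro mult_right_mono) auto
      also have "\<dots> = real k * (real k * (1 + x))" by simp
      also have "\<dots> \<le> (x * y) * y" using y x_pos y1 by (intro mult_mono) auto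
      finally show ?thesis .
    qed
    then have "(y * y) * ((real k + 2) * (1 + x)) \<le> (y * y) * ((x * y) * y)"
      by (intro mult_left_mono) auto
    also have "\<dots> = x * y ^ 4" by (simp add: eval_nat_numeral)
    also have "\<dots> \<le> x * (9 / 8) ^ D" using T4 x_pos by simp
    finally show ?thesis .
  qed
  show D: "D \<ge> 1"
  proof (rule ccontr)
    assume "\<not> D \<ge> 1"
    then have "D = 0" by simp
    moreover have "16 \<le> (real k + 2)\<^sup>2 * (1 + x)"
      using mult_mono[of 16 "(real k + 2)\<^sup>2" 1 "1 + x"] power_mono[of 4 "real k + 2" 2] k2 x_pos by simp
    ultimately show False using i by simp
  qed
  have \<delta>y: "\<delta> * y ^ (2 * k) \<le> 1"
    using mult_right_mono[OF T, of \<delta>] delta unfolding y_def mult.commute[of \<delta>] by simp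
  have m\<delta>: "real m * \<delta> \<le> 1" if "m \<le> 3 * k + 1" for m
  proof -
    have "real m \<le> real (3 * k + 1)" using that by (simp only: of_nat_le_iff)
    also have "\<dots> \<le> (real k + 2)\<^sup>2 * 1" by (simp add: power2_eq_square algebra_simps)
    also have "\<dots> \<le> (real k + 2)\<^sup>2 * (1 + x)" using x_pos by (intro mult_left_mono) auto
    also note i
    finally have "real m * \<delta> \<le> (9 / 8) ^ D * \<delta>" using delta by (intro mult_right_mono) auto
    then show ?thesis using delta by simp
  qed
  \<comment> \<open>As \<open>k + 1 \<le> 2 * k\<close>, there is room for an extra factor
    \<open>y\<close>, which pays for the surplus \<open>inverse r\<close> at index
    \<open>3 * k + 1\<close>.\<close>
  have \<delta>r: "\<delta> * inverse r ^ (3 * k) * y \<le> w k"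
  proof -
    have "\<delta> * inverse r ^ (3 * k) * y \<le> \<delta> * (w k * y ^ k) * y"
      using inverse_r_power[of k] delta y1 k unfolding y_def by (intro mult_left_mono mult_right_mono) auto
    also have "\<dots> = w k * (\<delta> * y ^ (k + 1))" by simp
    also have "\<dots> \<le> w k * (\<delta> * y ^ (2 * k))"
      using delta y1 k w_pos[of k] by (intro mult_left_mono power_increasing) auto
    also have "\<dots> \<le> w k * 1" using \<delta>y w_pos[of k] by (intro mult_left_mono) auto
    finally show ?thesis by simp
  qed
  have \<delta>r': "\<delta> * inverse r ^ (3 * k) \<le> w k"
  proof -
    have "\<delta> * inverse r ^ (3 * k) * 1 \<le> \<delta> * inverse r ^ (3 * k) * y"
      using y1 delta r_pos by (intro mult_left_mono) auto
    with \<delta>r show ?thesis by simp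
  qed
  show "rec_poly h (3 * i + 2) x \<le> (2 * 3 ^ i) ^ D * (w k * (real k + 2))"
  proof -
    have "inverse r ^ (3 * i + 2) \<le> inverse r ^ (3 * k)"
      using r_pos r_le_1 k by (intro power_increasing) (auto simp: one_le_inverse)
    then have "\<delta> * inverse r ^ (3 * i + 2) \<le> \<delta> * inverse r ^ (3 * k)"
      using delta by (intro mult_left_mono) auto
    then have "\<delta> * inverse r ^ (3 * i + 2) \<le> w k" using \<delta>r' by linarith
    then have "lead x (3 * i + 2) + 2 * \<delta> * inverse r ^ (3 * i + 2) \<le> w k * (real k + 2)"
      unfolding lead_closed w_Suc using k by (simp add: algebra_simps)
    then have "real (max_prod (3 * i + 2)) ^ D * (lead x (3 * i + 2) + 2 * \<delta> * inverse r ^ (3 * i + 2))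
      \<le> real (max_prod (3 * i + 2)) ^ D * (w k * (real k + 2))"
      by (intro mult_left_mono) auto
    with k have "rec_poly h (3 * i + 2) x \<le> real (max_prod (3 * i + 2)) ^ D * (w k * (real k + 2))"
      by (intro order_trans[OF P_upper_crude[OF D m\<delta>]]) auto
    then show ?thesis by (simp only: max_prod_closed of_nat_mult of_nat_power of_nat_numeral)
  qed
  show "rec_poly h (3 * i + 4) x \<le> (4 * 3 ^ i) ^ D * (w k * ((real k + 2) * (1 + x)))"
  proof -
    have "\<delta> * inverse r ^ (3 * i + 4) = \<delta> * inverse r ^ (3 * k) * inverse r"
      using k by (simp add: eval_nat_numeral)
    also have "\<dots> \<le> \<delta> * inverse r ^ (3 * k) * (x * z)"
      using inverse_r_le delta r_pos by (intro mult_left_mono) auto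
    also have "\<dots> \<le> \<delta> * inverse r ^ (3 * k) * (x * y)"
      using mult_right_mono[of 1 "real k" z] k2 z_pos delta r_pos x_pos
      unfolding y_def by (intro mult_left_mono) auto
    also have "\<dots> = x * (\<delta> * inverse r ^ (3 * k) * y)" by simp
    also have "\<dots> \<le> x * w k" using \<delta>r x_pos by (intro mult_left_mono) auto
    finally have "lead x (3 * i + 4) + 2 * \<delta> * inverse r ^ (3 * i + 4)
      \<le> real k * w k * (1 + x / 2) + 2 * (x * w k)"
      unfolding lead_closed times_divide_eq_left[symmetric] w_Suc using k by simp
    also have "\<dots> = w k * (real k * (1 + x / 2) + 2 * x)" by (simp add: algebra_simps)
    also have "\<dots> \<le> w k * ((real k + 2) * (1 + x))"
      using w_pos[of k] x_pos by (intro mult_left_mono) (auto simp: algebra_simps)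
    finally have "real (max_prod (3 * i + 4)) ^ D * (lead x (3 * i + 4) + 2 * \<delta> * inverse r ^ (3 * i + 4))
      \<le> real (max_prod (3 * i + 4)) ^ D * (w k * ((real k + 2) * (1 + x)))"
      by (intro mult_left_mono) auto
    with k have "rec_poly h (3 * i + 4) x \<le> real (max_prod (3 * i + 4)) ^ D * (w k * ((real k + 2) * (1 + x)))"
      by (intro order_trans[OF P_upper_crude[OF D m\<delta>]]) auto
    then show ?thesis by (simp only: max_prod_closed of_nat_mult of_nat_power of_nat_numeral)
  qed
qed

text \<open>The products to compare are \<open>2 * 3 ^ i * (4 * 3 ^ i) = 8 * 9 ^ i\<close> with
  \<open>(3 ^ (i + 1))\<^sup>2 = 9 * 9 ^ i\<close>, and
  \<open>(4 * 3 ^ i)\<^sup>2 = 16 * 9 ^ i\<close> with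
  \<open>3 ^ (i + 1) * (2 * 3 ^ (i + 1)) = 18 * 9 ^ i\<close>. Both ratios are 9/8.\<close>

lemma power_nine_eighths:
  "(8 * c) ^ D * (9 / 8) ^ D = (9 * c :: real) ^ D"
  "(16 * c) ^ D * (9 / 8) ^ D = (18 * c :: real) ^ D"
  unfolding power_mult_distrib[symmetric] by simp_all

lemma nine_power: "(9::real) ^ i = 3 ^ i * 3 ^ i"
  unfolding power_mult_distrib[symmetric] by simp

lemma P_lower_closed:
  "(3 ^ k) ^ D * w k \<le> rec_poly h (3 * k) x"
  "(2 * 3 ^ k) ^ D * (x * w k) \<le> rec_poly h (3 * k + 2) x"
  "(4 * 3 ^ k) ^ D * (real (k + 1) * w (k + 1) * (1 + x / 2)) \<le> rec_poly h (3 * k + 4) x"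
proof -
  show "(3 ^ k) ^ D * w k \<le> rec_poly h (3 * k) x"
    using P_lower[of "3 * k"] unfolding max_prod_closed lead_closed by (simp add: w_def)
  show "(2 * 3 ^ k) ^ D * (x * w k) \<le> rec_poly h (3 * k + 2) x"
    using P_lower[of "3 * k + 2"] unfolding max_prod_closed lead_closed by (simp add: w_def)
  show "(4 * 3 ^ k) ^ D * (real (k + 1) * w (k + 1) * (1 + x / 2)) \<le> rec_poly h (3 * k + 4) x"
    using P_lower[of "3 * k + 4"]
    unfolding max_prod_closed lead_closed times_divide_eq_left[symmetric] w_Suc by simp
qed

text \<open>The coefficients \<open>U\<close> and \<open>V\<close> stay abstract so that the general
  estimates and the sharper numerical ones for \<open>k = 1\<close> can both be inserted.\<close>

lemma Delta_nonneg:
  assumes k: "k = i + 1"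
    and U: "rec_poly h (3 * i + 2) x \<le> (2 * 3 ^ i) ^ D * (w k * U)"
    and V: "rec_poly h (3 * i + 4) x \<le> (4 * 3 ^ i) ^ D * (w k * V)"
    and UV: "U \<ge> 0" "U * V \<le> (9 / 8) ^ D"
  shows "Delta h (3 * k) x \<ge> 0"
proof -
  have "rec_poly h (3 * i + 2) x * rec_poly h (3 * i + 4) x
    \<le> ((2 * 3 ^ i) ^ D * (w k * U)) * ((4 * 3 ^ i) ^ D * (w k * V))"
    using U V UV w_pos[of k] P_nonneg by (intro mult_mono) auto
  also have "\<dots> = (8 * 9 ^ i) ^ D * (w k)\<^sup>2 * (U * V)"
  proof -
    have "(2 * 3 ^ i) ^ D * (4 * 3 ^ i) ^ D = (8 * 9 ^ i :: real) ^ D"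
      unfolding power_mult_distrib[symmetric] by (rule arg_cong[where f = "\<lambda>t. t ^ D"]) (simp add: nine_power)
    then show ?thesis by (simp only: power2_eq_square mult_ac)
  qed
  also have "\<dots> \<le> (8 * 9 ^ i) ^ D * (w k)\<^sup>2 * (9 / 8) ^ D"
    using UV by (intro mult_left_mono) auto
  also have "\<dots> = ((3 ^ k) ^ D * w k)\<^sup>2"
  proof -
    have "((3 ^ k) ^ D)\<^sup>2 = (9 * 9 ^ i :: real) ^ D"
      unfolding power2_eq_square power_mult_distrib[symmetric] k
      by (rule arg_cong[where f = "\<lambda>t. t ^ D"]) (simp add: nine_power)
    then show ?thesis using power_nine_eighths(1)[of "9 ^ i"] by (simp only: power_mult_distrib[where n = 2] mult_ac)
  qed
  also have "\<dots> \<le> (rec_poly h (3 * k) x)\<^sup>2"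
    using P_lower_closed(1)[of k] w_pos[of k] by (intro power_mono) auto
  finally have "rec_poly h (3 * i + 2) x * rec_poly h (3 * i + 4) x \<le> (rec_poly h (3 * k) x)\<^sup>2" .
  moreover have "3 * k - 1 = 3 * i + 2" "3 * k + 1 = 3 * i + 4" using k by auto
  ultimately show ?thesis by (simp only: Delta_def diff_ge_0_iff_ge)
qed

text \<open>The factor \<open>x\<close> in the condition on \<open>V\<close> comes from the leading
  coefficient \<open>x * w k\<close> at \<open>3 * k + 2\<close>.\<close>

lemma Delta_neg:
  assumes k: "k = i + 1"
    and V: "rec_poly h (3 * i + 4) x \<le> (4 * 3 ^ i) ^ D * (w k * V)"
    and V': "V\<^sup>2 < x * (9 / 8) ^ D"
  shows "Delta h (3 * k + 1) x < 0"
proof -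
  have "(rec_poly h (3 * i + 4) x)\<^sup>2 \<le> ((4 * 3 ^ i) ^ D * (w k * V))\<^sup>2"
    using V P_nonneg by (intro power_mono) auto
  also have "\<dots> = ((16 * 9 ^ i) ^ D * (w k)\<^sup>2) * V\<^sup>2"
  proof -
    have "((4 * 3 ^ i) ^ D)\<^sup>2 = (16 * 9 ^ i :: real) ^ D"
      unfolding power2_eq_square power_mult_distrib[symmetric]
      by (rule arg_cong[where f = "\<lambda>t. t ^ D"]) (simp add: nine_power)
    then show ?thesis by (simp only: power_mult_distrib[where n = 2] mult_ac)
  qed
  also have "\<dots> < ((16 * 9 ^ i) ^ D * (w k)\<^sup>2) * (x * (9 / 8) ^ D)"
    using V' w_pos[of k] by (intro mult_strict_left_mono) auto
  also have "\<dots> = ((3 ^ k) ^ D * w k) * ((2 * 3 ^ k) ^ D * (x * w k))"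
  proof -
    have "(3 ^ k) ^ D * (2 * 3 ^ k) ^ D = (18 * 9 ^ i :: real) ^ D"
      unfolding power_mult_distrib[symmetric] k
      by (rule arg_cong[where f = "\<lambda>t. t ^ D"]) (simp add: nine_power)
    then show ?thesis using power_nine_eighths(2)[of "9 ^ i"] by (simp only: power2_eq_square mult_ac)
  qed
  also have "\<dots> \<le> rec_poly h (3 * k) x * rec_poly h (3 * k + 2) x"
    using P_lower_closed[of k] w_pos[of k] x_pos P_nonneg by (intro mult_mono) auto
  finally have "(rec_poly h (3 * i + 4) x)\<^sup>2 < rec_poly h (3 * k) x * rec_poly h (3 * k + 2) x" .
  moreover have "3 * k + 1 - 1 = 3 * k" "3 * k + 1 + 1 = 3 * k + 2" "3 * k + 1 = 3 * i + 4" using k by auto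
  ultimately show ?thesis by (simp only: Delta_def diff_less_0_iff_less)
qed

section \<open>The small cases n = 3 and n = 4\<close>

text \<open>Since 3/4 * 9/8 = 27/32 < 1, the second error stays small even after multiplication by
  \<open>z\<^sup>2\<close>.\<close>

lemma eta_z:
  assumes "N \<le> D" "z\<^sup>2 \<le> (9 / 8) ^ D"
  shows "\<eta> * z\<^sup>2 \<le> (3 / 4) ^ N * (9 / 8) ^ N"
    and "\<delta> \<le> (8 / 9) ^ N" "\<eta> \<le> (3 / 4) ^ N"
proof -
  show d: "\<delta> \<le> (8 / 9) ^ N" "\<eta> \<le> (3 / 4) ^ N"
    unfolding \<delta>_def \<eta>_def using assms(1) by (auto intro: power_decreasing)
  have "\<eta> * z\<^sup>2 \<le> \<eta> * (9 / 8) ^ D" using assms eta by (intro mult_left_mono) auto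
  also have "\<dots> = (27 / 32) ^ D" unfolding \<eta>_def by (simp flip: power_mult_distrib)
  also have "\<dots> \<le> (27 / 32) ^ N" using assms(1) by (intro power_decreasing) auto
  also have "\<dots> = (3 / 4) ^ N * (9 / 8) ^ N" by (simp flip: power_mult_distrib)
  finally show "\<eta> * z\<^sup>2 \<le> (3 / 4) ^ N * (9 / 8) ^ N" .
qed

lemma w_1: "w 1 = x" by (simp add: w_def)

text \<open>Here \<open>inverse r ^ 2\<close> is enlarged to \<open>inverse r ^ 3 = x * z\<close>,
  and \<open>z \<ge> 93 / 50\<close> turns the bound on \<open>\<eta> * z\<^sup>2\<close> into one
  on \<open>\<eta> * z\<close>.\<close>

lemma P_2_upper:
  assumes "D \<ge> 1" "\<delta> \<le> c" "\<eta> * z\<^sup>2 \<le> e"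
  shows "rec_poly h 2 x \<le> 2 ^ D * (w 1 * (1 + c * x / 2 + e / (93 / 50)))"
proof -
  have "\<eta> * inverse r ^ 2 \<le> \<eta> * inverse r ^ 3"
    using eta r_pos r_le_1 by (intro mult_left_mono power_increasing) (auto simp: one_le_inverse)
  also have "\<dots> = x * (\<eta> * z)" unfolding inverse_r_3 by simp
  also have "\<dots> \<le> x * (e / (93 / 50))"
  proof -
    have "\<eta> * z * (93 / 50) \<le> \<eta> * z * z" using z_ge(3) eta z_pos by (intro mult_left_mono) auto
    also have "\<dots> \<le> e" using assms by (simp add: power2_eq_square mult.assoc)
    finally show ?thesis using x_pos by (intro mult_left_mono) (auto simp: field_simps)
  qed
  finally have 1: "\<eta> * inverse r ^ 2 \<le> x * (e / (93 / 50))" .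
  have 2: "\<delta> * x\<^sup>2 / 2 \<le> c * x\<^sup>2 / 2" using assms by (intro divide_right_mono mult_right_mono) auto
  have "rec_poly h 2 x \<le> 2 ^ D * ((1 - \<delta>) * x + \<delta> * (x + x\<^sup>2 / 2) + \<eta> * inverse r ^ 2)"
    using P_upper[OF assms(1), of 2] unfolding lead_small rec_poly_real_small max_prod_2 by simp
  also have "(1 - \<delta>) * x + \<delta> * (x + x\<^sup>2 / 2) + \<eta> * inverse r ^ 2 = x + \<delta> * x\<^sup>2 / 2 + \<eta> * inverse r ^ 2"
    by (simp add: algebra_simps)
  also have "2 ^ D * \<dots> \<le> 2 ^ D * (w 1 * (1 + c * x / 2 + e / (93 / 50)))"
    using 1 2 unfolding w_1 by (intro mult_left_mono) (auto simp: algebra_simps power2_eq_square)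
  finally show ?thesis .
qed

text \<open>Here \<open>inverse r ^ 4\<close> is enlarged to
  \<open>inverse r ^ 6 = (x * z)\<^sup>2\<close>; the constant 41/20 bounds
  \<open>2 + \<eta>\<close>.\<close>

lemma P_4_upper:
  assumes "D \<ge> 1" "\<delta> \<le> c" "\<eta> * z\<^sup>2 \<le> e" "\<eta> \<le> 1 / 20"
  shows "rec_poly h 4 x \<le> 4 ^ D * (w 1 * (1 + x / 2 + c * (x + x\<^sup>2 / 2 + x ^ 3 / 24) + 41 / 20 * e * x))"
proof -
  have "(1 + \<eta>) ^ 2 - 1 = \<eta> * (2 + \<eta>)" by (simp add: power2_eq_square algebra_simps)
  also have "\<dots> \<le> \<eta> * (41 / 20)" using eta(1) assms by (intro mult_left_mono) auto
  finally have "((1 + \<eta>) ^ 2 - 1) * inverse r ^ 4 \<le> \<eta> * (41 / 20) * inverse r ^ 6"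
    using eta(1) r_pos r_le_1
    by (intro mult_mono power_increasing) (auto simp: one_le_inverse)
  also have "inverse r ^ 6 = (x * z) ^ 2" unfolding inverse_r_3[symmetric] by (simp flip: power_mult)
  also have "\<eta> * (41 / 20) * (x * z) ^ 2 = (\<eta> * z\<^sup>2) * (41 / 20 * x\<^sup>2)" by (simp add: power_mult_distrib)
  also have "\<dots> \<le> e * (41 / 20 * x\<^sup>2)" using assms by (intro mult_right_mono) auto
  finally have 1: "((1 + \<eta>) ^ 2 - 1) * inverse r ^ 4 \<le> e * (41 / 20 * x\<^sup>2)" .
  have 2: "\<delta> * (x\<^sup>2 + x ^ 3 / 2 + x ^ 4 / 24) \<le> c * (x\<^sup>2 + x ^ 3 / 2 + x ^ 4 / 24)"
    using assms x_pos by (intro mult_right_mono) auto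
  have m: "max_prod 4 = 4" "lead x 4 = x * (1 + x / 2)"
    using max_prod_closed(3)[of 0] lead_closed(3)[of x 0] by simp_all
  have "rec_poly h 4 x \<le> 4 ^ D * ((1 - \<delta>) * (x * (1 + x / 2))
      + \<delta> * (x + 3 / 2 * x ^ 2 + x ^ 3 / 2 + x ^ 4 / 24) + ((1 + \<eta>) ^ 2 - 1) * inverse r ^ 4)"
    using P_upper[OF assms(1), of 4] unfolding m rec_poly_real_small by simp
  also have "(1 - \<delta>) * (x * (1 + x / 2)) + \<delta> * (x + 3 / 2 * x ^ 2 + x ^ 3 / 2 + x ^ 4 / 24)
    = x * (1 + x / 2) + \<delta> * (x\<^sup>2 + x ^ 3 / 2 + x ^ 4 / 24)"
    by (simp add: field_simps power2_eq_square)
  also have "4 ^ D * (\<dots> + ((1 + \<eta>) ^ 2 - 1) * inverse r ^ 4)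
    \<le> 4 ^ D * (x * (1 + x / 2) + c * (x\<^sup>2 + x ^ 3 / 2 + x ^ 4 / 24) + e * (41 / 20 * x\<^sup>2))"
    using 1 2 by (intro mult_left_mono) auto
  also have "x * (1 + x / 2) + c * (x\<^sup>2 + x ^ 3 / 2 + x ^ 4 / 24) + e * (41 / 20 * x\<^sup>2)
    = w 1 * (1 + x / 2 + c * (x + x\<^sup>2 / 2 + x ^ 3 / 24) + 41 / 20 * e * x)"
    unfolding w_1 by (simp add: algebra_simps eval_nat_numeral)
  finally show ?thesis .
qed

lemma Delta_3_nonneg:
  assumes T: "z\<^sup>2 \<le> (9 / 8) ^ D"
  shows "Delta h 3 x \<ge> 0"
proof -
  \<comment> \<open>The absolute bound on \<open>z\<close> forces \<open>D\<close> to be at least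
    11, which makes all errors explicit numbers.\<close>
  have "(9 / 8 :: real) ^ 10 < (93 / 50)\<^sup>2" by (simp add: eval_nat_numeral)
  also have "\<dots> \<le> z\<^sup>2" using z_ge(3) by (intro power_mono) auto
  also note T
  finally have D: "11 \<le> D" using nine_eighths_exponent_ge[of 10 D] by simp
  have \<delta>: "\<delta> \<le> 274 / 1000" and e: "\<eta> * z\<^sup>2 \<le> 16 / 100" and \<eta>: "\<eta> \<le> 1 / 20"
    using eta_z[OF D T] by (simp_all add: eval_nat_numeral)
  define U where "U = 1 + 274 / 1000 * x / 2 + 16 / 100 / (93 / 50)"
  define V where "V = 1 + x / 2 + 274 / 1000 * (x + x\<^sup>2 / 2 + x ^ 3 / 24) + 41 / 20 * (16 / 100) * x"
  have U: "0 \<le> U" "U \<le> 109 / 100 + 14 / 100 * x" using x_pos by (auto simp: U_def)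
  have V: "V \<le> 1 + 111 / 100 * x + 14 / 100 * x\<^sup>2 + 12 / 1000 * x ^ 3"
  proof -
    have "V = 1 + 1102 / 1000 * x + 137 / 1000 * x\<^sup>2 + 137 / 12000 * x ^ 3"
      by (simp add: V_def field_simps)
    then show ?thesis using x_pos zero_le_power2[of x] zero_less_power[OF x_pos, of 3] by linarith
  qed
  have "0 \<le> V" using x_pos by (auto simp: V_def)
  have "U * V \<le> (109 / 100 + 14 / 100 * x) * (1 + 111 / 100 * x + 14 / 100 * x\<^sup>2 + 12 / 1000 * x ^ 3)"
    using U V \<open>0 \<le> V\<close> x_pos by (intro mult_mono) auto
  also have "\<dots> \<le> z\<^sup>2"
  \<comment> \<open>For small \<open>x\<close> the constant bound 93/50 on \<open>z\<close>
    suffices; beyond that the quadratic bound takes over coefficientwise, up to the constant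
    term.\<close>
  proof (cases "x \<le> 1 / 5")
    case True
    have "(109 / 100 + 14 / 100 * x) * (1 + 111 / 100 * x + 14 / 100 * x\<^sup>2 + 12 / 1000 * x ^ 3)
      \<le> (109 / 100 + 14 / 100 * (1 / 5)) * (1 + 111 / 100 * (1 / 5) + 14 / 100 * (1 / 5)\<^sup>2 + 12 / 1000 * (1 / 5) ^ 3)"
      using x_pos True by (intro mult_mono add_mono power_mono) auto
    also have "\<dots> \<le> (93 / 50)\<^sup>2" by (simp add: eval_nat_numeral)
    also have "\<dots> \<le> z\<^sup>2" using z_ge(3) by (intro power_mono) auto
    finally show ?thesis .
  next
    case False
    have "(109 / 100 + 14 / 100 * x) * (1 + 111 / 100 * x + 14 / 100 * x\<^sup>2 + 12 / 1000 * x ^ 3)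
      = 109 / 100 + 13499 / 10000 * x + 308 / 1000 * x\<^sup>2 + 3268 / 100000 * x ^ 3 + 168 / 100000 * x ^ 4"
      by (simp add: eval_nat_numeral field_simps)
    also have "\<dots> \<le> 1 + 2 * x + 4 / 3 * x\<^sup>2 + 1 / 3 * x ^ 3 + 1 / 36 * x ^ 4"
      using False zero_less_power[OF x_pos, of 2] zero_less_power[OF x_pos, of 3] zero_less_power[OF x_pos, of 4]
      by linarith
    also have "\<dots> = (1 + x + x\<^sup>2 / 6)\<^sup>2" by (simp add: eval_nat_numeral field_simps)
    also have "\<dots> \<le> z\<^sup>2" using z_ge(2) x_pos by (intro power_mono) auto
    finally show ?thesis .
  qed
  finally have UV: "U * V \<le> (9 / 8) ^ D" using T by linarith
  have "Delta h (3 * 1) x \<ge> 0"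
  proof (rule Delta_nonneg[of 1 0 U V])
    show "rec_poly h (3 * 0 + 2) x \<le> (2 * 3 ^ 0) ^ D * (w 1 * U)"
      using P_2_upper[OF _ \<delta> e] D unfolding U_def by (simp add: numeral_2_eq_2)
    show "rec_poly h (3 * 0 + 4) x \<le> (4 * 3 ^ 0) ^ D * (w 1 * V)"
      using P_4_upper[OF _ \<delta> e \<eta>] D unfolding V_def by simp
  qed (use U UV in auto)
  then show ?thesis by simp
qed

lemma Delta_4_neg:
  assumes T: "z ^ 8 \<le> ((9 / 8) ^ D) ^ 3"
  shows "Delta h 4 x < 0"
proof -
  have "(9 / 8 :: real) ^ (14 * 3) < (93 / 50) ^ 8" by (simp add: eval_nat_numeral)
  also have "\<dots> \<le> z ^ 8" using z_ge(3) by (intro power_mono) auto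
  also note T
  finally have "((9 / 8 :: real) ^ 14) ^ 3 < ((9 / 8) ^ D) ^ 3" by (simp only: power_mult)
  then have "(9 / 8 :: real) ^ 14 < (9 / 8) ^ D" by (rule power_less_imp_less_base) simp
  then have D: "15 \<le> D" using nine_eighths_exponent_ge[of 14 D] by simp
  have z1: "z \<ge> 1" using z_ge(3) by simp
  have "(z\<^sup>2) ^ 3 \<le> z ^ 8" using z1 unfolding power_mult[symmetric] by (intro power_increasing) auto
  also note T
  finally have T2: "z\<^sup>2 \<le> (9 / 8) ^ D" by (subst (asm) power_mono_iff) auto
  have "(9 / 8 :: real) ^ 15 \<le> (9 / 8) ^ D" using D by (intro power_increasing) auto
  moreover have "569 / 100 \<le> (9 / 8 :: real) ^ 15" by (simp add: eval_nat_numeral)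
  ultimately have T15: "569 / 100 \<le> (9 / 8 :: real) ^ D" by linarith
  have \<delta>: "\<delta> \<le> 171 / 1000" and e: "\<eta> * z\<^sup>2 \<le> 79 / 1000" and \<eta>: "\<eta> \<le> 1 / 20"
    using eta_z[OF D T2] by (simp_all add: eval_nat_numeral)
  have neg: "Delta h 4 x < 0"
    if "\<delta> \<le> c" "(1 + x / 2 + c * (x + x\<^sup>2 / 2 + x ^ 3 / 24) + 41 / 20 * (79 / 1000) * x)\<^sup>2 < x * (9 / 8) ^ D" for c
  proof -
    have "Delta h (3 * 1 + 1) x < 0"
      using P_4_upper[OF _ that(1) e \<eta>] D that(2) by (intro Delta_neg[of 1 0]) auto
    then show ?thesis by simp
  qed
  show ?thesis
  proof (cases "x \<le> 1")
    case x1: True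
    define V where "V = 1 + x / 2 + 171 / 1000 * (x + x\<^sup>2 / 2 + x ^ 3 / 24) + 41 / 20 * (79 / 1000) * x"
    have V0: "0 \<le> V" using x_pos by (auto simp: V_def)
    have V: "V \<le> 1 + 84 / 100 * x + 86 / 1000 * x\<^sup>2 + 8 / 1000 * x ^ 3"
    proof -
      have "V = 1 + 83295 / 100000 * x + 171 / 2000 * x\<^sup>2 + 171 / 24000 * x ^ 3"
        by (simp add: V_def field_simps)
      then show ?thesis using x_pos zero_le_power2[of x] zero_less_power[OF x_pos, of 3] by linarith
    qed
    have "V\<^sup>2 < x * (9 / 8) ^ D"
    \<comment> \<open>For small \<open>x\<close> the chain
      \<open>V\<^sup>2 < 2 \<le> z \<le> x * z\<^sup>2\<close> decides; up to 1 the numerical bound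
      on \<open>(9 / 8) ^ D\<close> does.\<close>
    proof (cases "x \<le> 45 / 100")
      case True
      have "x\<^sup>2 \<le> (45 / 100)\<^sup>2" "x ^ 3 \<le> (45 / 100) ^ 3" using True x_pos by (auto intro: power_mono)
      then have "V \<le> 14 / 10" using V True by (simp add: eval_nat_numeral)
      then have "V\<^sup>2 \<le> (14 / 10)\<^sup>2" using V0 by (intro power_mono) auto
      also have "\<dots> < 2" by (simp add: eval_nat_numeral)
      also have "2 \<le> z"
      proof -
        have "x * z \<le> 45 / 100 * z" using True z1 by (intro mult_right_mono) auto
        with z_ge(1) show ?thesis by simp
      qed
      also have "z \<le> (x * z) * z" using mult_right_mono[OF z_ge(1), of z] z1 by simp
      also have "\<dots> = x * z\<^sup>2" by (simp add: power2_eq_square)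
      also have "\<dots> \<le> x * (9 / 8) ^ D" using T2 x_pos by (intro mult_left_mono) auto
      finally show ?thesis .
    next
      case False
      have "x ^ 3 \<le> x" "x\<^sup>2 \<le> x"
        using x1 x_pos power_decreasing[of 1 2 x] power_decreasing[of 1 3 x] by auto
      then have "V \<le> 1 + 94 / 100 * x" using V x_pos by linarith
      then have "V\<^sup>2 \<le> (1 + 94 / 100 * x)\<^sup>2" using V0 by (intro power_mono) auto
      also have "\<dots> = 1 + 188 / 100 * x + 8836 / 10000 * (x * x)" by (simp add: power2_eq_square algebra_simps)
      also have "\<dots> < 569 / 100 * x"
      proof -
        \<comment> \<open>The chord of \<open>x * x\<close> between 45/100 and 1.\<close>
        have "0 \<le> (x - 45 / 100) * (1 - x)" using False x1 by simp
        then have "x * x \<le> 145 / 100 * x - 45 / 100" by (simp add: field_simps)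
        then show ?thesis using False by linarith
      qed
      also have "\<dots> \<le> x * (9 / 8) ^ D" using mult_left_mono[OF T15, of x] x_pos by simp
      finally show ?thesis .
    qed
    then show ?thesis using neg[OF \<delta>] unfolding V_def by simp
  next
    case False
    define s where "s = x + x\<^sup>2 / 2 + x ^ 3 / 24"
    \<comment> \<open>For \<open>x > 1\<close> the bound on \<open>\<delta>\<close> must decrease
      with \<open>z\<close>, so that the growth of \<open>z\<^sup>2\<close> absorbs the cubic
      \<open>s\<close>.\<close>
    have \<delta>': "\<delta> \<le> 1 / z\<^sup>2"
    proof -
      have "\<delta> * z\<^sup>2 \<le> \<delta> * (9 / 8) ^ D" using T2 delta by (intro mult_left_mono) auto
      then show ?thesis using delta z_pos by (simp add: field_simps)
    qed
    have "s \<le> 4 / 10 * (1 + 2 * x + 4 / 3 * x\<^sup>2 + 1 / 3 * x ^ 3 + 1 / 36 * x ^ 4)"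
    proof -
      have "0 \<le> (x - 1)\<^sup>2 * (x + 2)" using x_pos by simp
      then have "3 * x \<le> x ^ 3 + 2" by (simp add: eval_nat_numeral algebra_simps)
      moreover have "4 / 10 * (1 + 2 * x + 4 / 3 * x\<^sup>2 + 1 / 3 * x ^ 3 + 1 / 36 * x ^ 4)
        = 2 / 5 + 4 / 5 * x + 8 / 15 * x\<^sup>2 + 2 / 15 * x ^ 3 + 1 / 90 * x ^ 4"
        by (simp add: field_simps)
      ultimately show ?thesis using zero_le_power2[of x] zero_less_power[OF x_pos, of 4] x_pos
        unfolding s_def by linarith
    qed
    also have "\<dots> = 4 / 10 * (1 + x + x\<^sup>2 / 6)\<^sup>2" by (simp add: eval_nat_numeral field_simps)
    also have "\<dots> \<le> 4 / 10 * z\<^sup>2" using z_ge(2) x_pos by (intro mult_left_mono power_mono) auto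
    finally have "1 / z\<^sup>2 * s \<le> 4 / 10" using z_pos by (simp add: field_simps)
    then have "1 + x / 2 + 1 / z\<^sup>2 * s + 41 / 20 * (79 / 1000) * x \<le> 14 / 10 + 662 / 1000 * x"
      using x_pos by linarith
    also have "\<dots> < 1 + x + x\<^sup>2 / 6"
      using False power_increasing[of 1 2 x] by simp
    also note z_ge(2)
    finally have "(1 + x / 2 + 1 / z\<^sup>2 * s + 41 / 20 * (79 / 1000) * x)\<^sup>2 < z\<^sup>2"
      using x_pos by (intro power_strict_mono) (auto simp: s_def)
    also have "\<dots> \<le> x * z\<^sup>2" using False mult_right_mono[of 1 x "z\<^sup>2"] by simp
    also have "\<dots> \<le> x * (9 / 8) ^ D" using T2 x_pos by (intro mult_left_mono) auto
    finally show ?thesis using neg[OF \<delta>'] unfolding s_def by simp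
  qed
qed

section \<open>Residue 2: comparison of leading coefficients\<close>

text \<open>The maximal products cancel, and \<open>1 + s\<close> is the quotient of the leading
  coefficients, \<open>lead x (3 * k + 1) * lead x (3 * k + 3)\<close> over the square of
  \<open>lead x (3 * k + 2)\<close>. If \<open>U\<close> is the relative error of the middle
  polynomial, the claim reduces to \<open>(1 + U)\<^sup>2 < 1 + s\<close>.\<close>

lemma Delta_2_mod_3_neg:
  assumes k: "k = i + 1" "k \<ge> 2"
  defines "s \<equiv> real k / (real k + 1) * (1 / x + 1 / 2) - 1"
  assumes s: "s > 0" and T: "3 * real k ^ k * inverse r ^ (3 * k + 2) \<le> s * x ^ (k + 1) * (9 / 8) ^ D"
  shows "Delta h (3 * k + 2) x < 0"
proof -
  define n where "n = 3 * k + 2"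
  have k2: "real k \<ge> 2" using k by simp
  have sx: "s * x \<le> 1 - x / 2"
  proof -
    have "real k / (real k + 1) * (1 / x + 1 / 2) \<le> 1 * (1 / x + 1 / 2)"
      using x_pos by (intro mult_right_mono) auto
    then have "s \<le> 1 / x - 1 / 2" by (simp add: s_def)
    then have "s * x \<le> (1 / x - 1 / 2) * x" using x_pos by (intro mult_right_mono) auto
    also have "\<dots> = 1 - x / 2" using x_pos by (simp add: left_diff_distrib)
    finally show ?thesis .
  qed
  have sx1: "s * x \<le> 1" using sx x_pos by simp
  have r1: "1 \<le> inverse r" using r_pos r_le_1 by (simp add: one_le_inverse)
  have Tx: "3 * real k ^ k * inverse r ^ n \<le> x ^ k * (9 / 8) ^ D"
  proof -
    have "s * x ^ (k + 1) * (9 / 8) ^ D = (s * x) * (x ^ k * (9 / 8) ^ D)" by simp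
    also have "\<dots> \<le> 1 * (x ^ k * (9 / 8) ^ D)"
      using sx1 x_pos by (intro mult_right_mono) auto
    finally show ?thesis using T by (simp add: n_def)
  qed
  have T3: "3 * (real k * z)\<^sup>2 \<le> (9 / 8) ^ D"
  proof -
    have "x ^ k * (3 * (real k * z) ^ k) = 3 * real k ^ k * inverse r ^ (3 * k)"
      unfolding inverse_r_3k by (simp only: power_mult_distrib mult_ac)
    also have "\<dots> \<le> 3 * real k ^ k * inverse r ^ n"
      using r1 unfolding n_def by (intro mult_left_mono power_increasing) auto
    also note Tx
    finally have "3 * (real k * z) ^ k \<le> (9 / 8) ^ D" using x_pos by simp
    moreover have "1 \<le> real k * z" using mult_mono[of 1 "real k" 1 z] k2 z_ge(3) by simp
    then have "(real k * z)\<^sup>2 \<le> (real k * z) ^ k" using k by (intro power_increasing) auto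
    ultimately show ?thesis by linarith
  qed
  have "10 * (real k * real k) \<le> (9 / 8) ^ D"
  proof -
    have "(93 / 50)\<^sup>2 \<le> z\<^sup>2" using z_ge(3) by (intro power_mono) auto
    then have "10 \<le> 3 * z\<^sup>2" by (simp add: eval_nat_numeral)
    then have "10 * (real k)\<^sup>2 \<le> 3 * z\<^sup>2 * (real k)\<^sup>2" by (intro mult_right_mono) auto
    then show ?thesis using T3 by (simp add: power_mult_distrib power2_eq_square algebra_simps)
  qed
  moreover have "2 * real k \<le> real k * real k" using k2 by (intro mult_right_mono) auto
  moreover have "real n = 3 * real k + 2" by (simp add: n_def)
  ultimately have "5 * real n \<le> (9 / 8) ^ D" using k2 by linarith
  then have "5 * real n * \<delta> \<le> (9 / 8) ^ D * \<delta>" using delta by (intro mult_right_mono) auto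
  then have n\<delta>: "real n * \<delta> \<le> 1 / 5" using delta by simp
  have D: "D \<ge> 1"
  proof (rule ccontr)
    assume "\<not> D \<ge> 1"
    then have "D = 0" by simp
    then show False using \<open>5 * real n \<le> (9 / 8) ^ D\<close> by (simp add: n_def)
  qed
  have \<eta>: "real n * \<eta> \<le> real n * \<delta> * \<delta>"
    using mult_left_mono[OF eta(2), of "real n"] by (simp add: power2_eq_square)
  have "real n * \<delta> * \<delta> \<le> 1 / 5 * 1" using n\<delta> delta by (intro mult_mono) auto
  then have E: "(1 + \<eta>) ^ (n div 2) - 1 \<le> real n * \<delta> * \<delta>"
    using power_one_plus_le[of \<eta> n] eta(1) \<eta> by linarith
  define L where "L = x * w k"
  have L0: "L > 0" using x_pos w_pos by (simp add: L_def)
  define u where "u = \<delta> * inverse r ^ n / L"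
  have u0: "u \<ge> 0" using delta r_pos L0 by (simp add: u_def)
  \<comment> \<open>With the factor 3 in \<open>T\<close>, this factor 2 yields
    \<open>u \<le> s / 6\<close>; it relies on \<open>k \<ge> 2\<close>.\<close>
  have fact: "2 * fact k \<le> real k ^ k"
  proof -
    have "(2::real) ^ 1 \<le> 2 ^ (k - 1)" using k by (intro power_increasing) auto
    then have "fact k * 2 \<le> fact k * (2::real) ^ (k - 1)" by simp
    with fact_le_self_power[of k] show ?thesis by linarith
  qed
  have L: "L * fact k = x ^ (k + 1)" by (simp add: L_def w_def)
  have u: "u \<le> s / 6"
  proof -
    have "2 * fact k * (3 * (\<delta> * inverse r ^ n)) \<le> real k ^ k * (3 * (\<delta> * inverse r ^ n))"
      using fact delta r_pos by (intro mult_right_mono) auto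
    also have "\<dots> = \<delta> * (3 * real k ^ k * inverse r ^ n)" by simp
    also have "\<dots> \<le> \<delta> * (s * x ^ (k + 1) * (9 / 8) ^ D)"
      using T delta unfolding n_def by (intro mult_left_mono) auto
    also have "\<dots> = s * x ^ (k + 1) * ((9 / 8) ^ D * \<delta>)" by (simp only: mult_ac)
    also have "\<dots> = s * L * fact k" unfolding delta L[symmetric] by simp
    finally have "6 * (\<delta> * inverse r ^ n) \<le> s * L" by simp
    moreover have "s / 6 * L = s * L / 6" by simp
    ultimately show ?thesis unfolding u_def pos_divide_le_eq[OF L0] by linarith
  qed
  \<comment> \<open>The error from non-maximal products relative to \<open>L\<close>. It is bounded
    by \<open>u\<close> in general, but more sharply for small \<open>x\<close>.\<close>
  define q where "q = \<delta> * rec_poly real n x / L"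
  have qu: "q \<le> u" unfolding q_def u_def
    using real_bound delta L0 by (intro divide_right_mono mult_left_mono) auto
  define U where "U = q + real n * \<delta> * u"
  have U0: "U \<ge> 0" unfolding U_def q_def using u0 delta L0 x_pos
    by (intro add_nonneg_nonneg mult_nonneg_nonneg divide_nonneg_pos rec_poly_nonneg) auto
  have lead: "lead x n = L" unfolding n_def lead_closed by (simp add: L_def w_def)
  have upper: "rec_poly h n x \<le> (2 * 3 ^ k) ^ D * (L * (1 + U))"
  proof -
    have "((1 + \<eta>) ^ (n div 2) - 1) * inverse r ^ n \<le> real n * \<delta> * \<delta> * inverse r ^ n"
      using E r_pos by (intro mult_right_mono) auto
    also have "\<dots> = L * (real n * \<delta> * u)" using L0 by (simp add: u_def)
    finally have "((1 + \<eta>) ^ (n div 2) - 1) * inverse r ^ n \<le> L * (real n * \<delta> * u)" .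
    moreover have "(1 - \<delta>) * L \<le> L" using delta L0 by (intro mult_left_le_one_le) auto
    ultimately have "(1 - \<delta>) * lead x n + \<delta> * rec_poly real n x + ((1 + \<eta>) ^ (n div 2) - 1) * inverse r ^ n
      \<le> L + \<delta> * rec_poly real n x + L * (real n * \<delta> * u)"
      unfolding lead by linarith
    also have "\<dots> = L * (1 + U)" using L0 by (simp add: U_def q_def field_simps)
    finally have "real (max_prod n) ^ D * ((1 - \<delta>) * lead x n + \<delta> * rec_poly real n x
      + ((1 + \<eta>) ^ (n div 2) - 1) * inverse r ^ n) \<le> real (max_prod n) ^ D * (L * (1 + U))"
      by (intro mult_left_mono) auto
    from order_trans[OF P_upper[OF D] this] show ?thesis
      by (simp only: n_def max_prod_closed of_nat_mult of_nat_power of_nat_numeral)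
  qed
  have "(1 + U)\<^sup>2 < 1 + s"
  \<comment> \<open>With \<open>U \<le> s / 5\<close> the inequality
    \<open>(1 + U)\<^sup>2 < 1 + s\<close> follows exactly up to \<open>s = 15\<close>. For larger
    \<open>s\<close>, \<open>x\<close> is at most 1/15 and \<open>U \<le> 1\<close> is shown
    instead.\<close>
  proof (cases "s < 15")
    case True
    have "real n * \<delta> * u \<le> 1 / 5 * u" using n\<delta> u0 by (intro mult_right_mono) auto
    then have "U \<le> s / 5" using qu u unfolding U_def by linarith
    then have "(1 + U)\<^sup>2 \<le> (1 + s / 5)\<^sup>2" using U0 by (intro power_mono) auto
    also have "\<dots> = 1 + s * (2 / 5 + s / 25)" by (simp add: power2_eq_square field_simps)
    also have "\<dots> < 1 + s * 1" using True s by (intro add_strict_left_mono mult_strict_left_mono) auto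
    finally show ?thesis by simp
  next
    case False
    have "15 * x \<le> s * x" using False x_pos by (intro mult_right_mono) auto
    then have x15: "x \<le> 1 / 15" using sx1 by simp
    have "q \<le> 44 / 100"
    proof -
      have "rec_poly real n x \<le> x * (1 + x) ^ (n - 1)"
        using x_pos by (intro rec_poly_real_le) (auto simp: n_def)
      also have "\<dots> \<le> x * (16 / 15) ^ (n - 1)"
        using x_pos x15 by (intro mult_left_mono power_mono) auto
      finally have "\<delta> * rec_poly real n x \<le> \<delta> * (x * (16 / 15) ^ (n - 1))"
        using delta by (intro mult_left_mono) auto
      then have q: "q \<le> \<delta> / w k * (16 / 15) ^ (n - 1)"
        using x_pos w_pos[of k] by (simp add: q_def L_def field_simps)
      have "3 * real k ^ k * 1 \<le> 3 * real k ^ k * inverse r ^ n"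
        using r1 by (intro mult_left_mono) (auto simp: one_le_power)
      also note Tx
      finally have "3 * real k ^ k * \<delta> \<le> x ^ k * (9 / 8) ^ D * \<delta>"
        using delta by (intro mult_right_mono) auto
      also have "\<dots> = w k * fact k" using delta(3) by (simp add: w_def mult.assoc)
      finally have "3 * real k ^ k * \<delta> \<le> w k * fact k" .
      moreover have "3 * (fact k * 2 ^ i) * \<delta> \<le> 3 * real k ^ k * \<delta>"
        using k fact_le_self_power[of k] delta by (intro mult_left_mono mult_right_mono) auto
      ultimately have "3 * (fact k * 2 ^ i) * \<delta> \<le> w k * fact k" by linarith
      then have "fact k * (3 * 2 ^ i * \<delta>) \<le> fact k * w k"
        by (simp only: mult_ac)
      then have "3 * 2 ^ i * \<delta> \<le> w k" by simp
      \<comment> \<open>The decay \<open>2 ^ i\<close> outweighs the growth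
        \<open>(16 / 15) ^ 3 < 2\<close> per step of \<open>i\<close>, leaving
        \<open>(16 / 15) ^ 4 / 3 < 44 / 100\<close>.\<close>
      then have "\<delta> / w k \<le> 1 / (3 * 2 ^ i)"
        using w_pos[of k] by (simp add: field_simps)
      then have "\<delta> / w k * (16 / 15) ^ (n - 1) \<le> 1 / (3 * 2 ^ i) * (16 / 15) ^ (n - 1)"
        by (intro mult_right_mono) auto
      also have "\<dots> = 1 / (3 * 2 ^ i) * ((16 / 15) ^ 4 * ((16 / 15) ^ 3) ^ i)"
      proof -
        have "n - 1 = 4 + 3 * i" by (simp add: n_def k)
        then show ?thesis by (simp only: power_mult power_add)
      qed
      also have "\<dots> \<le> 1 / (3 * 2 ^ i) * ((16 / 15) ^ 4 * (2::real) ^ i)"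
        by (intro mult_left_mono power_mono) (auto simp: eval_nat_numeral)
      also have "\<dots> \<le> 44 / 100" by (simp add: eval_nat_numeral)
      finally show ?thesis using q by linarith
    qed
    moreover have "real n * \<delta> * u \<le> 1 / 100"
    proof -
      \<comment> \<open>This bounds \<open>n * \<delta>\<close> by a multiple of
        \<open>x\<^sup>2\<close>, which compensates for \<open>s\<close> being as large as
        \<open>1 / x\<close>.\<close>
      have "real k \<le> x * (real k * z)" using mult_left_mono[OF z_ge(1), of "real k"] by (simp add: mult_ac)
      then have "(real k)\<^sup>2 \<le> (x * (real k * z))\<^sup>2" by (intro power_mono) auto
      also have "\<dots> = x\<^sup>2 * (real k * z)\<^sup>2" by (simp add: power_mult_distrib)
      also have "\<dots> \<le> x\<^sup>2 * ((9 / 8) ^ D / 3)" using T3 by (intro mult_left_mono) auto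
      finally have "(real k)\<^sup>2 * \<delta> \<le> x\<^sup>2 * ((9 / 8) ^ D / 3) * \<delta>"
        using delta by (intro mult_right_mono) auto
      also have "\<dots> = x\<^sup>2 / 3" using delta(3) by (simp add: mult.assoc)
      finally have k\<delta>: "(real k)\<^sup>2 * \<delta> \<le> x\<^sup>2 / 3" .
      have "2 * real n \<le> 4 * (real k)\<^sup>2"
        using \<open>2 * real k \<le> real k * real k\<close> \<open>real n = 3 * real k + 2\<close> k2
        unfolding power2_eq_square by linarith
      then have "real n * \<delta> \<le> 2 * ((real k)\<^sup>2 * \<delta>)"
        using mult_right_mono[of "2 * real n" "4 * (real k)\<^sup>2" \<delta>] delta by (simp add: mult.assoc)
      also have "\<dots> \<le> 2 * (x\<^sup>2 / 3)" using k\<delta> by (intro mult_left_mono) auto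
      finally have "real n * \<delta> \<le> 2 * (x\<^sup>2 / 3)" .
      then have "real n * \<delta> * u \<le> 2 * (x\<^sup>2 / 3) * (s / 6)"
        using u u0 delta by (intro mult_mono[of "real n * \<delta>"]) auto
      also have "\<dots> = (s * x) * x / 9" by (simp add: power2_eq_square)
      also have "\<dots> \<le> 1 * (1 / 15) / 9"
        using sx1 x15 x_pos by (intro divide_right_mono mult_mono) auto
      finally show ?thesis by simp
    qed
    ultimately have "U \<le> 1" unfolding U_def by linarith
    then have "(1 + U)\<^sup>2 \<le> 2\<^sup>2" using U0 by (intro power_mono) auto
    then show ?thesis using False by simp
  qed
  then have main: "(L * (1 + U))\<^sup>2 < (real k * w k * (1 + x / 2)) * w (k + 1)"
  proof -
    have wk: "w (k + 1) = x * w k / (real k + 1)" by (simp add: w_def field_simps)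
    have "(L * (1 + U))\<^sup>2 = L\<^sup>2 * (1 + U)\<^sup>2" by (simp add: power_mult_distrib)
    also have "\<dots> < L\<^sup>2 * (1 + s)" using \<open>(1 + U)\<^sup>2 < 1 + s\<close> L0 by (intro mult_strict_left_mono) auto
    also have "\<dots> = (real k * w k * (1 + x / 2)) * w (k + 1)"
    proof -
      define p where "p = 1 + x / 2"
      have "1 + s = real k / (real k + 1) * (p / x)"
        using x_pos by (simp add: s_def p_def add_divide_distrib)
      then show ?thesis
        unfolding wk L_def p_def[symmetric] using x_pos by (simp add: power2_eq_square mult_ac)
    qed
    finally show ?thesis .
  qed
  have "(rec_poly h n x)\<^sup>2 \<le> ((2 * 3 ^ k) ^ D * (L * (1 + U)))\<^sup>2"
    using upper P_nonneg by (intro power_mono) auto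
  also have "\<dots> = (4 * 9 ^ k) ^ D * (L * (1 + U))\<^sup>2"
  proof -
    have "((2 * 3 ^ k) ^ D)\<^sup>2 = (4 * 9 ^ k :: real) ^ D"
      unfolding power2_eq_square power_mult_distrib[symmetric]
      by (rule arg_cong[where f = "\<lambda>t. t ^ D"]) (simp add: nine_power)
    then show ?thesis by (simp only: power_mult_distrib[where n = 2])
  qed
  also have "\<dots> < (4 * 9 ^ k) ^ D * ((real k * w k * (1 + x / 2)) * w (k + 1))"
    using main by (intro mult_strict_left_mono) auto
  also have "\<dots> = ((4 * 3 ^ i) ^ D * (real k * w k * (1 + x / 2))) * ((3 ^ (k + 1)) ^ D * w (k + 1))"
  proof -
    have "(4 * 3 ^ i) ^ D * (3 ^ (k + 1)) ^ D = (4 * 9 ^ k :: real) ^ D"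
      unfolding power_mult_distrib[symmetric] k
      by (rule arg_cong[where f = "\<lambda>t. t ^ D"]) (simp add: nine_power)
    then show ?thesis by (simp only: mult_ac)
  qed
  also have "\<dots> \<le> rec_poly h (3 * i + 4) x * rec_poly h (3 * (k + 1)) x"
    using P_lower_closed(3)[of i] P_lower_closed(1)[of "k + 1"] w_pos x_pos P_nonneg less_imp_le[OF w_pos]
    unfolding k(1)[symmetric] by (intro mult_mono mult_nonneg_nonneg) auto
  finally have "(rec_poly h n x)\<^sup>2 < rec_poly h (3 * i + 4) x * rec_poly h (3 * (k + 1)) x" .
  moreover have "3 * k + 2 - 1 = 3 * i + 4" "3 * k + 2 + 1 = 3 * (k + 1)" using k by auto
  ultimately show ?thesis by (simp only: Delta_def diff_less_0_iff_less n_def)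
qed

section \<open>From logarithmic thresholds to inequalities between powers\<close>

lemma ln_scale:
  assumes "c > 0"
  shows "ln (c * z) = ln c - ln x - 3 * ln r"
  using assms x_pos r_pos z_pos by (simp add: z_def ln_mult_pos ln_inverse ln_realpow)

lemma Delta_0_mod_3:
  assumes k: "k \<ge> 1" and T: "(real k * z) ^ (2 * k) \<le> (9 / 8) ^ D"
  shows "Delta h (3 * k) x \<ge> 0"
proof (cases "k = 1")
  case True
  then show ?thesis using Delta_3_nonneg T by simp
next
  case False
  define i where "i = k - 1"
  have i: "k = i + 1" "k \<ge> 2" using k False by (auto simp: i_def)
  note c = estimates_k_ge_2[OF i T]
  have "(real k + 2) * ((real k + 2) * (1 + x)) \<le> (9 / 8) ^ D"
    using c(4) by (simp add: power2_eq_square mult.assoc)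
  then show ?thesis using Delta_nonneg[OF i(1) c(2,3)] by simp
qed

text \<open>The exponent \<open>2 * n / 3\<close> is not an integer for
  \<open>n = 3 * k + 1\<close>, so the threshold is stated in cubed form.\<close>

lemma Delta_1_mod_3:
  assumes k: "k \<ge> 1" and T: "(real k * z) ^ (6 * k + 2) \<le> (9 / 8) ^ (3 * D)"
  shows "Delta h (3 * k + 1) x < 0"
proof (cases "k = 1")
  case True
  then show ?thesis using Delta_4_neg T by (simp add: power_mult mult.commute)
next
  case False
  define i where "i = k - 1"
  have i: "k = i + 1" "k \<ge> 2" using k False by (auto simp: i_def)
  have "1 \<le> real k * z" using mult_mono[of 1 "real k" 1 z] k z_ge(3) by simp
  then have "((real k * z) ^ (2 * k)) ^ 3 \<le> (real k * z) ^ (6 * k + 2)"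
    unfolding power_mult[symmetric] by (intro power_increasing) auto
  also note T
  also have "(9 / 8 :: real) ^ (3 * D) = ((9 / 8) ^ D) ^ 3" by (simp add: power_mult mult.commute)
  finally have "(real k * z) ^ (2 * k) \<le> (9 / 8) ^ D"
    using z_pos by (subst (asm) power_mono_iff) auto
  note c = estimates_k_ge_2[OF i this]
  show ?thesis using Delta_neg[OF i(1) c(3,5)] .
qed

end

lemma power_le_power_ln:
  fixes y b :: real
  assumes "y > 0" "b > 0" "real m * ln y \<le> real N * ln b"
  shows "y ^ m \<le> b ^ N"
proof -
  have "ln (y ^ m) \<le> ln (b ^ N)" using assms by (simp add: ln_realpow)
  then show ?thesis using assms by (subst (asm) ln_le_cancel_iff) auto
qed

text \<open>The condition at \<open>d = 1\<close> gives \<open>g 1 j \<ge> j\<close>; this bounds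
  the radius of convergence by 1 and hence yields \<open>r \<le> 1\<close>.\<close>

lemma perturbed_powers_double_seqs:
  assumes g: "g \<in> double_seqs" and "d \<ge> 1" "x > 0" "0 < r"
    and "ereal r < conv_radius (\<lambda>m. g 1 m / real m)"
    and "\<And>m. rec_poly (g 1) m x \<le> inverse r ^ m"
  shows "perturbed_powers (g d) (g 1) (d - 1) x r"
proof
  have *: "0 \<le> g e j - real j ^ e" "g e j - real j ^ e \<le> g 1 j * (real j - 1) ^ (e - 1)"
    if "e \<ge> 1" "j \<ge> 1" for e j
    using g that by (auto simp: double_seqs_def)
  have d: "d - 1 + 1 = d" using assms by simp
  show "real j ^ (d - 1 + 1) \<le> g d j" "g d j \<le> real j ^ (d - 1 + 1) + g 1 j * (real j - 1) ^ (d - 1)"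
    if "j \<ge> 1" for j
    unfolding d using *[OF \<open>d \<ge> 1\<close> that] by linarith+
  show g1: "real j \<le> g 1 j" if "j \<ge> 1" for j
    using *(1)[of 1 j] that by simp
  have "conv_radius (\<lambda>m. g 1 m / real m) \<le> 1"
    using g1 by (intro conv_radius_le_one) simp
  with assms have "ereal r < 1" by (meson less_le_trans)
  then show "r \<le> 1" by (simp add: one_ereal_def)
qed (use assms in auto)

theorem theorem2:
  fixes g :: "nat \<Rightarrow> nat \<Rightarrow> real" and n :: nat and r :: "real \<Rightarrow> real"
  assumes "g \<in> double_seqs"
    and "n \<ge> 3" and "n \<noteq> 5"
    and "\<And>x. x > 0 \<Longrightarrow> 0 < r x"
    and "\<And>x. x > 0 \<Longrightarrow> ereal (r x) < conv_radius (\<lambda>m. g 1 m / real m)"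
    and "\<And>x m. x > 0 \<Longrightarrow> rec_poly (g 1) m x \<le> inverse (r x) ^ m"
  shows "(n mod 3 = 0 \<longrightarrow> (\<forall>x>0. \<forall>d\<ge>1.
            real d \<ge> 1 + 2 * real n / (3 * ln (9 / 8)) *
                       (ln (real n / 3) - ln x - 3 * ln (r x))
            \<longrightarrow> Delta (g d) n x \<ge> 0)) \<and>
         (n mod 3 = 1 \<longrightarrow> (\<forall>x>0. \<forall>d\<ge>1.
            real d \<ge> 1 + 2 * real n / (3 * ln (9 / 8)) *
                       (ln ((real n - 1) / 3) - ln x - 3 * ln (r x))
            \<longrightarrow> Delta (g d) n x < 0)) \<and>
         (n mod 3 = 2 \<longrightarrow> (\<forall>x. 0 < x \<and> x < 2 - 12 / (real n + 4) \<longrightarrow> (\<forall>d\<ge>1.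
            real d \<ge> 1 + 1 / ln (9 / 8) *
                       (- ln ((real n - 2) / (3 * real n + 3) * (1 / x + 1 / 2) - 1 / 3)
                        + (real n - 2) / 3 * ln ((real n - 2) / 3)
                        - (real n + 1) / 3 * ln x - real n * ln (r x))
            \<longrightarrow> Delta (g d) n x < 0)))"
proof (intro conjI impI allI)
  have c: "ln (9 / 8 :: real) > 0" by simp
  have PP: "perturbed_powers (g d) (g 1) (d - 1) x (r x)" if "x > 0" "d \<ge> 1" for x d
    using assms that by (intro perturbed_powers_double_seqs) auto
  {
    fix x :: real and d :: nat
    assume n: "n mod 3 = 0" and x: "x > 0" and d: "d \<ge> 1"
      and le: "1 + 2 * real n / (3 * ln (9 / 8)) * (ln (real n / 3) - ln x - 3 * ln (r x)) \<le> real d"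
    interpret perturbed_powers "g d" "g 1" "d - 1" x "r x" using x d by (rule PP)
    obtain k where k: "n = 3 * k" using n by (auto simp: mod_eq_0_iff_dvd)
    have k1: "k \<ge> 1" using k \<open>n \<ge> 3\<close> by simp
    have "real (2 * k) / ln (9 / 8) * ln (real k * z) \<le> real (d - 1)"
      using le d k1 by (simp add: k ln_scale)
    then have "real (2 * k) * ln (real k * z) \<le> real (d - 1) * ln (9 / 8)"
      using c by (simp add: field_simps)
    then have "(real k * z) ^ (2 * k) \<le> (9 / 8) ^ (d - 1)"
      using k1 z_pos by (intro power_le_power_ln) auto
    then show "Delta (g d) n x \<ge> 0" unfolding k using k1 by (intro Delta_0_mod_3)
  next
    fix x :: real and d :: nat
    assume n: "n mod 3 = 1" and x: "x > 0" and d: "d \<ge> 1"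
      and le: "1 + 2 * real n / (3 * ln (9 / 8)) * (ln ((real n - 1) / 3) - ln x - 3 * ln (r x)) \<le> real d"
    interpret perturbed_powers "g d" "g 1" "d - 1" x "r x" using x d by (rule PP)
    define k where "k = n div 3"
    have k: "n = 3 * k + 1" using n div_mult_mod_eq[of n 3] by (simp add: k_def)
    have k1: "k \<ge> 1" using k \<open>n \<ge> 3\<close> by simp
    have "real (6 * k + 2) / (3 * ln (9 / 8)) * ln (real k * z) \<le> real (d - 1)"
      using le d k1 by (simp add: k ln_scale)
    then have "real (6 * k + 2) * ln (real k * z) \<le> real (3 * (d - 1)) * ln (9 / 8)"
      using c by (simp add: field_simps)
    then have "(real k * z) ^ (6 * k + 2) \<le> (9 / 8) ^ (3 * (d - 1))"
      using k1 z_pos by (intro power_le_power_ln) auto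
    then show "Delta (g d) n x < 0" unfolding k using k1 by (intro Delta_1_mod_3)
  next
    fix x :: real and d :: nat
    assume n: "n mod 3 = 2" and x: "0 < x \<and> x < 2 - 12 / (real n + 4)" and d: "d \<ge> 1"
      and le: "1 + 1 / ln (9 / 8) * (- ln ((real n - 2) / (3 * real n + 3) * (1 / x + 1 / 2) - 1 / 3)
                        + (real n - 2) / 3 * ln ((real n - 2) / 3)
                        - (real n + 1) / 3 * ln x - real n * ln (r x)) \<le> real d"
    interpret perturbed_powers "g d" "g 1" "d - 1" x "r x" using x d by (intro PP) auto
    define k where "k = n div 3"
    have k: "n = 3 * k + 2" using n div_mult_mod_eq[of n 3] by (simp add: k_def)
    have k2: "k \<ge> 2" using k \<open>n \<ge> 3\<close> \<open>n \<noteq> 5\<close> by simp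
    define i where "i = k - 1"
    have i: "k = i + 1" using k2 by (simp add: i_def)
    define s where "s = real k / (real k + 1) * (1 / x + 1 / 2) - 1"
    have s3: "(real n - 2) / (3 * real n + 3) * (1 / x + 1 / 2) - 1 / 3 = s / 3"
    proof -
      have "(real n - 2) / (3 * real n + 3) = real k / (real k + 1) / 3"
        by (simp add: k field_simps)
      then show ?thesis by (simp add: s_def diff_divide_distrib)
    qed
    \<comment> \<open>With \<open>n = 3 * k + 2\<close>, the upper bound
      \<open>2 - 12 / (n + 4)\<close> equals \<open>2 * k / (k + 2)\<close>, which is the zero of
      \<open>s\<close> as a function of \<open>x\<close>.\<close>
    have s: "s > 0"
    proof -
      have "x < 2 * real k / (real k + 2)"
        using x by (simp add: k field_simps)
      then have "x * (real k + 2) < 2 * real k" by (simp add: field_simps)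
      moreover have "s = (2 * real k - x * (real k + 2)) / (2 * x * (real k + 1))"
        using x_pos by (simp add: s_def divide_simps) (simp add: algebra_simps)
      ultimately show ?thesis using x_pos by simp
    qed
    \<comment> \<open>The bracket of the threshold; exponentiating
      \<open>B \<le> D * ln (9 / 8)\<close> gives the hypothesis \<open>T\<close> of
      \<open>Delta_2_mod_3_neg\<close>.\<close>
    define B where "B = - ln (s / 3) + real k * ln (real k) - (real k + 1) * ln x - real n * ln (r x)"
    have "1 / ln (9 / 8) * B \<le> real (d - 1)"
    proof -
      have e: "(real n - 2) / 3 = real k" "(real n + 1) / 3 = real k + 1" by (simp_all add: k)
      show ?thesis using le d unfolding s3 e B_def by simp
    qed
    then have B: "B \<le> real (d - 1) * ln (9 / 8)" using c by (simp add: field_simps)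
    have "ln (3 * real k ^ k * inverse (r x) ^ n) = ln 3 + real k * ln (real k) - real n * ln (r x)"
      using k2 r_pos by (simp add: ln_mult_pos ln_realpow ln_inverse)
    also have "\<dots> = ln s + (real k + 1) * ln x + B"
      using s by (simp add: B_def ln_div)
    also have "\<dots> \<le> ln s + (real k + 1) * ln x + real (d - 1) * ln (9 / 8)" using B by simp
    also have "\<dots> = ln (s * x ^ (k + 1) * (9 / 8) ^ (d - 1))"
      using s x_pos by (simp add: ln_mult_pos ln_realpow algebra_simps)
    finally have "3 * real k ^ k * inverse (r x) ^ n \<le> s * x ^ (k + 1) * (9 / 8) ^ (d - 1)"
      using s x_pos r_pos k2 by (subst (asm) ln_le_cancel_iff) auto
    then show "Delta (g d) n x < 0"
      using Delta_2_mod_3_neg[OF i k2] s unfolding k s_def by simp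
  }
qed

end
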